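(* Let $B$ be a ring, $\rho$ an automorphism of $B$, and let $f=X^m+X^{m-1}a_{m-1}+\cdots+Xa_1+a_0$ (with $m\ge 2$) be in $B[X;\rho]_{(0)}\cap B^{\rho}[X]$. Then $f$ is weakly separable in $B[X;\rho]$ if and only if $$\{ g \in J_\rho \mid \tau(g)= 0\} =\{ x(\tilde{\rho}(h)-h) \mid h \in V \}.$$
   Context: Rings are associative with identity, not necessarily commutative. $B[X;\rho]$ is the skew polynomial ring whose elements are $\sum_j X^j c_j$ ($c_j\in B$), with multiplication determined by $\alpha X=X\rho(\alpha)$ for $\alpha\in B$. $B[X;\rho]_{(0)}$ is the set of all monic $g\in B[X;\rho]$ with $gB[X;\rho]=B[X;\rho]g$. $B^\rho=\{\alpha\in B\mid \rho(\alpha)=\alpha\}$, and $f\in B^\rho[X]$ means that all coefficients $a_j$ of $f$ lie in $B^\rho$. Put $a_m=1$. Set $A=B[X;\rho]/fB[X;\rho]$, a ring extension of $B$ that is free with basis $1,x,\dots,x^{m-1}$, where $x=X+fB[X;\rho]$. Since $f\in B[X;\rho]_{(0)}\cap B^\rho[X]$, $\rho$ induces an automorphism $\tilde\rho$ of $A$ given by $\tilde\rho(\sum_{j=0}^{m-1}x^jc_j)=\sum_{j=0}^{m-1}x^j\rho(c_j)$. Let $V=V_A(B)$ be the centralizer of $B$ in $A$, and for $k\ge1$ let $J_{\rho^k}=\{h\in A\mid \alpha h=h\rho^k(\alpha)\ \text{for all }\alpha\in B\}$. The map $\tau:J_\rho\to J_{\rho^m}$ is $$\tau(h)=\sum_{k=0}^{m-1}x^k\sum_{j=0}^{k}\tilde\rho^{\,j}(h)\,a_{k+1}.$$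 A $B$-derivation of $A$ is an additive map $\delta:A\to A$ with $\delta(yz)=\delta(y)z+y\delta(z)$ for all $y,z\in A$ and $\delta(\alpha)=0$ for all $\alpha\in B$; it is inner if there is $u\in A$ with $\delta(y)=uy-yu$ for all $y\in A$. $A/B$ is weakly separable if every $B$-derivation of $A$ to $A$ is inner. The polynomial $f$ is weakly separable in $B[X;\rho]$ if $A$ is weakly separable over $B$. *)

theory Defs
  imports "HOL-Algebra.QuotRing" "HOL-Algebra.UnivPoly"
begin

section \<open>Skew polynomial rings\<close>

text \<open>
  Coefficients are written on the right: a finitely supported sequence \<open>p\<close> stands for
  \<open>\<Sum>j. X^j (p j)\<close>.  Since \<open>\<alpha> X^j = X^j (\<rho>^j \<alpha>)\<close>, the product
  \<open>(X^i (p i)) (X^j (q j))\<close> is \<open>X^(i+j) (\<rho>^j (p i)) (q j)\<close>.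
\<close>

definition skew_poly_ring :: "('a, 'm) ring_scheme \<Rightarrow> ('a \<Rightarrow> 'a) \<Rightarrow> (nat \<Rightarrow> 'a) ring" where
  "skew_poly_ring B \<rho> =
    \<lparr>carrier = up B,
     mult = (\<lambda>p q n. \<Oplus>\<^bsub>B\<^esub>i\<in>{..n}. (\<rho> ^^ (n - i)) (p i) \<otimes>\<^bsub>B\<^esub> q (n - i)),
     one = (\<lambda>n. if n = 0 then \<one>\<^bsub>B\<^esub> else \<zero>\<^bsub>B\<^esub>),
     zero = (\<lambda>n. \<zero>\<^bsub>B\<^esub>),
     add = (\<lambda>p q n. p n \<oplus>\<^bsub>B\<^esub> q n)\<rparr>"

definition skew_const :: "('a, 'm) ring_scheme \<Rightarrow> 'a \<Rightarrow> nat \<Rightarrow> 'a" where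
  "skew_const B \<alpha> = (\<lambda>n. if n = 0 then \<alpha> else \<zero>\<^bsub>B\<^esub>)"

definition skew_X :: "('a, 'm) ring_scheme \<Rightarrow> nat \<Rightarrow> 'a" where
  "skew_X B = (\<lambda>n. if n = 1 then \<one>\<^bsub>B\<^esub> else \<zero>\<^bsub>B\<^esub>)"

definition skew_monic :: "('a, 'm) ring_scheme \<Rightarrow> nat \<Rightarrow> (nat \<Rightarrow> 'a) \<Rightarrow> bool" where
  "skew_monic B m g \<longleftrightarrow> g m = \<one>\<^bsub>B\<^esub> \<and> (\<forall>k>m. g k = \<zero>\<^bsub>B\<^esub>)"

text \<open>The set \<open>B[X;\<rho>]\<^sub>(\<^sub>0\<^sub>)\<close>: monic \<open>g\<close> with \<open>g B[X;\<rho>] = B[X;\<rho>] g\<close>.\<close>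

definition skew_poly_0 :: "('a, 'm) ring_scheme \<Rightarrow> ('a \<Rightarrow> 'a) \<Rightarrow> (nat \<Rightarrow> 'a) set" where
  "skew_poly_0 B \<rho> = {g \<in> carrier (skew_poly_ring B \<rho>). (\<exists>m. skew_monic B m g) \<and>
      g <#\<^bsub>skew_poly_ring B \<rho>\<^esub> carrier (skew_poly_ring B \<rho>)
        = carrier (skew_poly_ring B \<rho>) #>\<^bsub>skew_poly_ring B \<rho>\<^esub> g}"

definition fixed_elements :: "('a, 'm) ring_scheme \<Rightarrow> ('a \<Rightarrow> 'a) \<Rightarrow> 'a set" where
  "fixed_elements B \<rho> = {\<alpha> \<in> carrier B. \<rho> \<alpha> = \<alpha>}"

definition fixed_polys :: "('a, 'm) ring_scheme \<Rightarrow> ('a \<Rightarrow> 'a) \<Rightarrow> (nat \<Rightarrow> 'a) set" where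
  "fixed_polys B \<rho> = {p \<in> carrier (skew_poly_ring B \<rho>). \<forall>j. p j \<in> fixed_elements B \<rho>}"

text \<open>The defining relation \<open>\<alpha> X = X \<rho>(\<alpha>)\<close> of the skew polynomial ring.\<close>

lemma skew_const_mult_X:
  assumes "ring B" "\<rho> \<in> ring_iso B B" "\<alpha> \<in> carrier B"
  shows "skew_const B \<alpha> \<otimes>\<^bsub>skew_poly_ring B \<rho>\<^esub> skew_X B
       = skew_X B \<otimes>\<^bsub>skew_poly_ring B \<rho>\<^esub> skew_const B (\<rho> \<alpha>)"
proof
  fix n
  interpret B: ring B by fact
  have hom: "\<rho> \<in> ring_hom B B" using assms(2) by (simp add: ring_iso_def)
  have cl: "\<And>b. b \<in> carrier B \<Longrightarrow> \<rho> b \<in> carrier B" using ring_hom_closed[OF hom] .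
  have zero: "\<And>k. (\<rho> ^^ k) \<zero>\<^bsub>B\<^esub> = \<zero>\<^bsub>B\<^esub>"
    by (induct_tac k) (simp_all add: ring_hom_zero[OF hom assms(1) assms(1)])
  have pcl: "\<And>k b. b \<in> carrier B \<Longrightarrow> (\<rho> ^^ k) b \<in> carrier B"
    by (induct_tac k) (auto simp: cl)
  have "(\<Oplus>\<^bsub>B\<^esub>i\<in>{..n}. (\<rho> ^^ (n - i)) (skew_const B \<alpha> i) \<otimes>\<^bsub>B\<^esub> skew_X B (n - i))
      = (\<Oplus>\<^bsub>B\<^esub>i\<in>{..n}. if 0 = i then (if n = 1 then \<rho> \<alpha> else \<zero>\<^bsub>B\<^esub>) else \<zero>\<^bsub>B\<^esub>)"
    using assms(3)
    by (intro B.finsum_cong') (auto simp: skew_const_def skew_X_def zero cl pcl)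
  also have "\<dots> = (if n = 1 then \<rho> \<alpha> else \<zero>\<^bsub>B\<^esub>)"
    using assms(3) by (subst B.finsum_singleton) (auto simp: cl)
  finally have l: "(\<Oplus>\<^bsub>B\<^esub>i\<in>{..n}. (\<rho> ^^ (n - i)) (skew_const B \<alpha> i) \<otimes>\<^bsub>B\<^esub> skew_X B (n - i))
      = (if n = 1 then \<rho> \<alpha> else \<zero>\<^bsub>B\<^esub>)" .
  have "(\<Oplus>\<^bsub>B\<^esub>i\<in>{..n}. (\<rho> ^^ (n - i)) (skew_X B i) \<otimes>\<^bsub>B\<^esub> skew_const B (\<rho> \<alpha>) (n - i))
      = (\<Oplus>\<^bsub>B\<^esub>i\<in>{..n}. if n = i then (if n = 1 then \<rho> \<alpha> else \<zero>\<^bsub>B\<^esub>) else \<zero>\<^bsub>B\<^esub>)"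
    using assms(3)
    by (intro B.finsum_cong') (auto simp: skew_const_def skew_X_def zero cl pcl)
  also have "\<dots> = (if n = 1 then \<rho> \<alpha> else \<zero>\<^bsub>B\<^esub>)"
    using assms(3) by (subst B.finsum_singleton) (auto simp: cl)
  finally show "(skew_const B \<alpha> \<otimes>\<^bsub>skew_poly_ring B \<rho>\<^esub> skew_X B) n
       = (skew_X B \<otimes>\<^bsub>skew_poly_ring B \<rho>\<^esub> skew_const B (\<rho> \<alpha>)) n"
    using l by (simp add: skew_poly_ring_def)
qed


section \<open>Derivations and weak separability\<close>

text \<open>
  A ring extension is given by a ring \<open>A\<close> together with the image \<open>S \<subseteq> carrier A\<close> of the base ring.
\<close>

definition is_derivation :: "('a, 'm) ring_scheme \<Rightarrow> 'a set \<Rightarrow> ('a \<Rightarrow> 'a) \<Rightarrow> bool" where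
  "is_derivation A S \<delta> \<longleftrightarrow>
     \<delta> \<in> carrier A \<rightarrow> carrier A \<and>
     (\<forall>y\<in>carrier A. \<forall>z\<in>carrier A. \<delta> (y \<oplus>\<^bsub>A\<^esub> z) = \<delta> y \<oplus>\<^bsub>A\<^esub> \<delta> z) \<and>
     (\<forall>y\<in>carrier A. \<forall>z\<in>carrier A. \<delta> (y \<otimes>\<^bsub>A\<^esub> z) = \<delta> y \<otimes>\<^bsub>A\<^esub> z \<oplus>\<^bsub>A\<^esub> y \<otimes>\<^bsub>A\<^esub> \<delta> z) \<and>
     (\<forall>\<alpha>\<in>S. \<delta> \<alpha> = \<zero>\<^bsub>A\<^esub>)"

definition is_inner :: "('a, 'm) ring_scheme \<Rightarrow> ('a \<Rightarrow> 'a) \<Rightarrow> bool" where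
  "is_inner A \<delta> \<longleftrightarrow>
     (\<exists>u\<in>carrier A. \<forall>y\<in>carrier A. \<delta> y = u \<otimes>\<^bsub>A\<^esub> y \<ominus>\<^bsub>A\<^esub> y \<otimes>\<^bsub>A\<^esub> u)"

definition weakly_separable_ext :: "('a, 'm) ring_scheme \<Rightarrow> 'a set \<Rightarrow> bool" where
  "weakly_separable_ext A S \<longleftrightarrow> (\<forall>\<delta>. is_derivation A S \<delta> \<longrightarrow> is_inner A \<delta>)"

definition centralizer_in :: "('a, 'm) ring_scheme \<Rightarrow> 'a set \<Rightarrow> 'a set" where
  "centralizer_in A S = {h \<in> carrier A. \<forall>s\<in>S. s \<otimes>\<^bsub>A\<^esub> h = h \<otimes>\<^bsub>A\<^esub> s}"


section \<open>The quotient \<open>A = B[X;\<rho>] / f B[X;\<rho>]\<close>\<close>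

definition skew_ideal ::
    "('a, 'm) ring_scheme \<Rightarrow> ('a \<Rightarrow> 'a) \<Rightarrow> (nat \<Rightarrow> 'a) \<Rightarrow> (nat \<Rightarrow> 'a) set" where
  "skew_ideal B \<rho> f = f <#\<^bsub>skew_poly_ring B \<rho>\<^esub> carrier (skew_poly_ring B \<rho>)"

definition skew_quot ::
    "('a, 'm) ring_scheme \<Rightarrow> ('a \<Rightarrow> 'a) \<Rightarrow> (nat \<Rightarrow> 'a) \<Rightarrow> (nat \<Rightarrow> 'a) set ring" where
  "skew_quot B \<rho> f = skew_poly_ring B \<rho> Quot skew_ideal B \<rho> f"

definition quot_const ::
    "('a, 'm) ring_scheme \<Rightarrow> ('a \<Rightarrow> 'a) \<Rightarrow> (nat \<Rightarrow> 'a) \<Rightarrow> 'a \<Rightarrow> (nat \<Rightarrow> 'a) set" where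
  "quot_const B \<rho> f \<alpha> = skew_ideal B \<rho> f +>\<^bsub>skew_poly_ring B \<rho>\<^esub> skew_const B \<alpha>"

definition quot_x ::
    "('a, 'm) ring_scheme \<Rightarrow> ('a \<Rightarrow> 'a) \<Rightarrow> (nat \<Rightarrow> 'a) \<Rightarrow> (nat \<Rightarrow> 'a) set" where
  "quot_x B \<rho> f = skew_ideal B \<rho> f +>\<^bsub>skew_poly_ring B \<rho>\<^esub> skew_X B"

definition weakly_separable_poly ::
    "('a, 'm) ring_scheme \<Rightarrow> ('a \<Rightarrow> 'a) \<Rightarrow> (nat \<Rightarrow> 'a) \<Rightarrow> bool" where
  "weakly_separable_poly B \<rho> f \<longleftrightarrow>
     weakly_separable_ext (skew_quot B \<rho> f) (quot_const B \<rho> f ` carrier B)"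

definition quot_V ::
    "('a, 'm) ring_scheme \<Rightarrow> ('a \<Rightarrow> 'a) \<Rightarrow> (nat \<Rightarrow> 'a) \<Rightarrow> (nat \<Rightarrow> 'a) set set" where
  "quot_V B \<rho> f = centralizer_in (skew_quot B \<rho> f) (quot_const B \<rho> f ` carrier B)"

definition quot_J ::
    "('a, 'm) ring_scheme \<Rightarrow> ('a \<Rightarrow> 'a) \<Rightarrow> (nat \<Rightarrow> 'a) \<Rightarrow> nat \<Rightarrow> (nat \<Rightarrow> 'a) set set" where
  "quot_J B \<rho> f k = {h \<in> carrier (skew_quot B \<rho> f). \<forall>\<alpha>\<in>carrier B.
      quot_const B \<rho> f \<alpha> \<otimes>\<^bsub>skew_quot B \<rho> f\<^esub> h
        = h \<otimes>\<^bsub>skew_quot B \<rho> f\<^esub> quot_const B \<rho> f ((\<rho> ^^ k) \<alpha>)}"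

text \<open>The element \<open>\<Sum>j<m. x^j c\<^sub>j\<close> of \<open>A\<close>.\<close>

definition quot_lincomb ::
    "('a, 'm) ring_scheme \<Rightarrow> ('a \<Rightarrow> 'a) \<Rightarrow> (nat \<Rightarrow> 'a) \<Rightarrow> nat \<Rightarrow> (nat \<Rightarrow> 'a) \<Rightarrow> (nat \<Rightarrow> 'a) set" where
  "quot_lincomb B \<rho> f m c =
     (\<Oplus>\<^bsub>skew_quot B \<rho> f\<^esub>j\<in>{..<m}.
        (quot_x B \<rho> f [^]\<^bsub>skew_quot B \<rho> f\<^esub> j) \<otimes>\<^bsub>skew_quot B \<rho> f\<^esub> quot_const B \<rho> f (c j))"

text \<open>
  For \<open>f\<close> monic of degree \<open>m\<close> in \<open>B[X;\<rho>]\<^sub>(\<^sub>0\<^sub>)\<close> the powers \<open>1, x, \<dots>, x^(m-1)\<close> form a basis of \<open>A\<close>,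
  so the description below determines a unique element for every \<open>h \<in> A\<close>.
\<close>

definition quot_rho ::
    "('a, 'm) ring_scheme \<Rightarrow> ('a \<Rightarrow> 'a) \<Rightarrow> (nat \<Rightarrow> 'a) \<Rightarrow> nat \<Rightarrow> (nat \<Rightarrow> 'a) set \<Rightarrow> (nat \<Rightarrow> 'a) set" where
  "quot_rho B \<rho> f m h =
     (THE y. \<exists>c \<in> {..<m} \<rightarrow> carrier B.
        h = quot_lincomb B \<rho> f m c \<and> y = quot_lincomb B \<rho> f m (\<lambda>j. \<rho> (c j)))"

text \<open>Here \<open>f (k + 1)\<close> is the coefficient \<open>a\<^sub>k\<^sub>+\<^sub>1\<close> of \<open>f\<close>; in particular \<open>f m = 1\<close>.\<close>

definition quot_tau ::
    "('a, 'm) ring_scheme \<Rightarrow> ('a \<Rightarrow> 'a) \<Rightarrow> (nat \<Rightarrow> 'a) \<Rightarrow> nat \<Rightarrow> (nat \<Rightarrow> 'a) set \<Rightarrow> (nat \<Rightarrow> 'a) set" where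
  "quot_tau B \<rho> f m h =
     (\<Oplus>\<^bsub>skew_quot B \<rho> f\<^esub>k\<in>{..<m}.
        (quot_x B \<rho> f [^]\<^bsub>skew_quot B \<rho> f\<^esub> k) \<otimes>\<^bsub>skew_quot B \<rho> f\<^esub>
        (\<Oplus>\<^bsub>skew_quot B \<rho> f\<^esub>j\<in>{..k}.
           (quot_rho B \<rho> f m ^^ j) h \<otimes>\<^bsub>skew_quot B \<rho> f\<^esub> quot_const B \<rho> f (f (k + 1))))"

end

theory Submission
  imports Defs
begin

text \<open>
  Write \<open>S = B[X;\<rho>]\<close>, \<open>A = S / f S\<close>, and let \<open>x\<close> be the class of \<open>X\<close>.  A \<open>B\<close>-derivation \<open>\<delta>\<close> of \<open>A\<close> is
  determined by \<open>g = \<delta> x\<close>, because \<open>A\<close> is generated by \<open>B\<close> and \<open>x\<close>.  The theorem holds because the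
  elements \<open>g\<close> that arise are exactly those of \<open>J\<^sub>\<rho>\<close> with \<open>\<tau> g = 0\<close>, while the inner derivations
  among them give exactly the elements \<open>x (\<rho> h - h)\<close> with \<open>h\<close> in the centralizer of \<open>B\<close>, where \<open>\<rho>\<close>
  also denotes the induced automorphism of \<open>A\<close>.

  Two relations hold in \<open>A\<close>, and each restricts \<open>g\<close>.  Differentiating \<open>\<alpha> x = x \<rho>(\<alpha>)\<close> gives
  \<open>\<alpha> g = g \<rho>(\<alpha>)\<close>, that is, \<open>g \<in> J\<^sub>\<rho>\<close>.  Differentiating \<open>f(x) = 0\<close> gives
  \<open>\<Sum>k<m. (\<Sum>j\<le>k. x^(k - j) g x^j) a\<^sub>k\<^sub>+\<^sub>1 = 0\<close>; since \<open>y x = x \<rho>(y)\<close> for all \<open>y\<close> in \<open>A\<close>, the left-hand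
  side is \<open>\<tau> g\<close> (lemmas \<open>tau_eq_D_f\<close> and \<open>derivation_tau\<close>).

  Conversely, let \<open>g \<in> J\<^sub>\<rho>\<close>.  The recursion \<open>D(\<alpha> + X t) = g t + x D(t)\<close> defines a map from \<open>S\<close> to \<open>A\<close>
  that satisfies the Leibniz rule (lemma \<open>D_mult\<close>).  If \<open>\<tau> g = D f\<close> vanishes, then \<open>D\<close> vanishes on
  \<open>f S\<close> and induces a derivation of \<open>A\<close> with \<open>\<delta> x = g\<close> (lemma \<open>derivation_exists\<close>).

  The derivation \<open>y \<mapsto> u y - y u\<close> kills \<open>B\<close> if and only if \<open>u\<close> centralizes \<open>B\<close>, and its value at \<open>x\<close> is
  \<open>u x - x u = x (\<rho> u - u)\<close> (lemma \<open>ad_x\<close>).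
\<close>

section \<open>The skew polynomial ring\<close>

locale skew_poly = ring B for B :: "('a, 'm) ring_scheme" (structure) +
  fixes \<rho> :: "'a \<Rightarrow> 'a"
  assumes rho_iso: "\<rho> \<in> ring_iso B B"
begin

abbreviation S :: "(nat \<Rightarrow> 'a) ring" where "S \<equiv> skew_poly_ring B \<rho>"
abbreviation const :: "'a \<Rightarrow> nat \<Rightarrow> 'a" where "const \<equiv> skew_const B"
abbreviation X :: "nat \<Rightarrow> 'a" where "X \<equiv> skew_X B"

lemma rho_hom: "\<rho> \<in> ring_hom B B"
  using rho_iso by (simp add: ring_iso_def)

lemma rho_pow_hom: "(\<rho> ^^ k) \<in> ring_hom B B"
proof (induction k)
  case 0
  show ?case by (auto intro!: ring_hom_memI)
next
  case (Suc k)
  show ?case using ring_hom_trans[OF Suc rho_hom] by (simp only: funpow.simps(2))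
qed

lemma rho_pow_rho_pow: "(\<rho> ^^ i) ((\<rho> ^^ j) \<alpha>) = (\<rho> ^^ (i + j)) \<alpha>"
  by (simp add: Nat.funpow_add)

lemma rho_closed [simp]: "\<alpha> \<in> carrier B \<Longrightarrow> \<rho> \<alpha> \<in> carrier B"
  and rho_add [simp]: "\<alpha> \<in> carrier B \<Longrightarrow> \<beta> \<in> carrier B \<Longrightarrow> \<rho> (\<alpha> \<oplus> \<beta>) = \<rho> \<alpha> \<oplus> \<rho> \<beta>"
  and rho_zero [simp]: "\<rho> \<zero> = \<zero>"
  using ring_hom_memE[OF rho_hom] ring_hom_zero[OF rho_hom ring_axioms ring_axioms] by auto

lemma rho_pow_closed [simp]: "\<alpha> \<in> carrier B \<Longrightarrow> (\<rho> ^^ k) \<alpha> \<in> carrier B"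
  and rho_pow_add [simp]: "\<alpha> \<in> carrier B \<Longrightarrow> \<beta> \<in> carrier B \<Longrightarrow>
    (\<rho> ^^ k) (\<alpha> \<oplus> \<beta>) = (\<rho> ^^ k) \<alpha> \<oplus> (\<rho> ^^ k) \<beta>"
  and rho_pow_mult [simp]: "\<alpha> \<in> carrier B \<Longrightarrow> \<beta> \<in> carrier B \<Longrightarrow>
    (\<rho> ^^ k) (\<alpha> \<otimes> \<beta>) = (\<rho> ^^ k) \<alpha> \<otimes> (\<rho> ^^ k) \<beta>"
  and rho_pow_one [simp]: "(\<rho> ^^ k) \<one> = \<one>"
  and rho_pow_zero [simp]: "(\<rho> ^^ k) \<zero> = \<zero>"
  using ring_hom_memE[OF rho_pow_hom[of k]]
    ring_hom_zero[OF rho_pow_hom[of k] ring_axioms ring_axioms] by auto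

lemma mem_S: "p \<in> carrier S \<longleftrightarrow> (\<forall>k. p k \<in> carrier B) \<and> (\<exists>N. \<forall>k\<ge>N. p k = \<zero>)"
proof -
  have "(\<exists>n. bound \<zero> n p) \<longleftrightarrow> (\<exists>N. \<forall>k\<ge>N. p k = \<zero>)"
  proof
    assume "\<exists>n. bound \<zero> n p"
    then obtain n where "bound \<zero> n p" ..
    then have "\<forall>k\<ge>Suc n. p k = \<zero>" by (auto simp: bound_def)
    then show "\<exists>N. \<forall>k\<ge>N. p k = \<zero>" ..
  next
    assume "\<exists>N. \<forall>k\<ge>N. p k = \<zero>"
    then obtain N where "\<forall>k\<ge>N. p k = \<zero>" ..
    then have "bound \<zero> N p" by (auto simp: bound_def)
    then show "\<exists>n. bound \<zero> n p" ..
  qed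
  then show ?thesis by (auto simp: skew_poly_ring_def up_def)
qed

lemma coeff_closed [simp]: "p \<in> carrier S \<Longrightarrow> p k \<in> carrier B"
  by (simp add: mem_S)

lemma S_add: "p \<oplus>\<^bsub>S\<^esub> q = (\<lambda>n. p n \<oplus> q n)"
  and S_zero: "\<zero>\<^bsub>S\<^esub> = (\<lambda>n. \<zero>)"
  and S_one: "\<one>\<^bsub>S\<^esub> = const \<one>"
  and S_mult: "(p \<otimes>\<^bsub>S\<^esub> q) n = (\<Oplus>i\<in>{..n}. (\<rho> ^^ (n - i)) (p i) \<otimes> q (n - i))"
  by (simp_all add: skew_poly_ring_def skew_const_def)

lemma const_closed [simp]: "\<alpha> \<in> carrier B \<Longrightarrow> const \<alpha> \<in> carrier S"
  by (auto simp: mem_S skew_const_def intro!: exI[of _ 1])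

lemma X_closed [simp]: "X \<in> carrier S"
  by (auto simp: mem_S skew_X_def intro!: exI[of _ 2])

lemma S_add_closed: "p \<in> carrier S \<Longrightarrow> q \<in> carrier S \<Longrightarrow> p \<oplus>\<^bsub>S\<^esub> q \<in> carrier S"
  unfolding mem_S S_add
  by (auto, metis add.r_cancel_one' max.bounded_iff zero_closed)

lemma S_mult_closed:
  assumes p: "p \<in> carrier S" and q: "q \<in> carrier S"
  shows "p \<otimes>\<^bsub>S\<^esub> q \<in> carrier S"
proof -
  obtain N M where N: "\<forall>k\<ge>N. p k = \<zero>" and M: "\<forall>k\<ge>M. q k = \<zero>"
    using p q by (auto simp: mem_S)
  have "(p \<otimes>\<^bsub>S\<^esub> q) n = \<zero>" if "n \<ge> N + M" for n
  proof -
    have "(\<rho> ^^ (n - i)) (p i) \<otimes> q (n - i) = \<zero>" if "i \<le> n" for i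
    proof (cases "i \<ge> N")
      case True
      then show ?thesis using N q by simp
    next
      case False
      then have "n - i \<ge> M" using \<open>n \<ge> N + M\<close> by simp
      then show ?thesis using M p by simp
    qed
    then show ?thesis unfolding S_mult by (auto intro: add.finprod_one_eqI)
  qed
  moreover have "(p \<otimes>\<^bsub>S\<^esub> q) n \<in> carrier B" for n
    unfolding S_mult using p q by auto
  ultimately show ?thesis unfolding mem_S by blast
qed

lemma const_mult:
  assumes "\<alpha> \<in> carrier B" "p \<in> carrier S"
  shows "const \<alpha> \<otimes>\<^bsub>S\<^esub> p = (\<lambda>n. (\<rho> ^^ n) \<alpha> \<otimes> p n)"
proof
  fix n
  have "(const \<alpha> \<otimes>\<^bsub>S\<^esub> p) n = (\<Oplus>i\<in>{..n}. if 0 = i then (\<rho> ^^ n) \<alpha> \<otimes> p n else \<zero>)"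
    unfolding S_mult using assms by (intro finsum_cong') (auto simp: skew_const_def)
  also have "\<dots> = (\<rho> ^^ n) \<alpha> \<otimes> p n"
    using assms by (subst finsum_singleton) auto
  finally show "(const \<alpha> \<otimes>\<^bsub>S\<^esub> p) n = (\<rho> ^^ n) \<alpha> \<otimes> p n" .
qed

lemma mult_const:
  assumes "\<alpha> \<in> carrier B" "p \<in> carrier S"
  shows "p \<otimes>\<^bsub>S\<^esub> const \<alpha> = (\<lambda>n. p n \<otimes> \<alpha>)"
proof
  fix n
  have "(p \<otimes>\<^bsub>S\<^esub> const \<alpha>) n = (\<Oplus>i\<in>{..n}. if n = i then p n \<otimes> \<alpha> else \<zero>)"
    unfolding S_mult using assms by (intro finsum_cong') (auto simp: skew_const_def)
  also have "\<dots> = p n \<otimes> \<alpha>"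
    using assms by (subst finsum_singleton) auto
  finally show "(p \<otimes>\<^bsub>S\<^esub> const \<alpha>) n = p n \<otimes> \<alpha>" .
qed

lemma const_zero: "const \<zero> = \<zero>\<^bsub>S\<^esub>"
  by (simp add: skew_const_def S_zero)

lemma const_mult_const:
  "\<alpha> \<in> carrier B \<Longrightarrow> \<beta> \<in> carrier B \<Longrightarrow> const \<alpha> \<otimes>\<^bsub>S\<^esub> const \<beta> = const (\<alpha> \<otimes> \<beta>)"
  by (simp add: mult_const) (auto simp: skew_const_def)

lemma X_mult:
  assumes "p \<in> carrier S"
  shows "X \<otimes>\<^bsub>S\<^esub> p = (\<lambda>n. case n of 0 \<Rightarrow> \<zero> | Suc k \<Rightarrow> p k)"
proof
  fix n
  show "(X \<otimes>\<^bsub>S\<^esub> p) n = (case n of 0 \<Rightarrow> \<zero> | Suc k \<Rightarrow> p k)"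
  proof (cases n)
    case 0
    then show ?thesis using assms by (simp add: S_mult skew_X_def)
  next
    case (Suc k)
    have "(X \<otimes>\<^bsub>S\<^esub> p) n = (\<Oplus>i\<in>{..n}. if 1 = i then p k else \<zero>)"
      unfolding S_mult using assms Suc by (intro finsum_cong') (auto simp: skew_X_def)
    also have "\<dots> = p k"
      using assms Suc by (subst finsum_singleton) auto
    finally show ?thesis using Suc by simp
  qed
qed

text \<open>Every skew polynomial is built from \<open>0\<close> by the operation \<open>t \<mapsto> \<alpha> + X t\<close>.  As left
  multiplication by \<open>X\<close> merely shifts coefficients, this Horner form turns most identities in
  \<open>S\<close> into inductions that never touch a convolution sum.\<close>

lemma skew_poly_decomp:
  assumes "p \<in> carrier S"
  shows "(\<lambda>k. p (Suc k)) \<in> carrier S"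
    and "p = const (p 0) \<oplus>\<^bsub>S\<^esub> X \<otimes>\<^bsub>S\<^esub> (\<lambda>k. p (Suc k))"
proof -
  show t: "(\<lambda>k. p (Suc k)) \<in> carrier S"
    using assms unfolding mem_S by (meson le_SucI)
  show "p = const (p 0) \<oplus>\<^bsub>S\<^esub> X \<otimes>\<^bsub>S\<^esub> (\<lambda>k. p (Suc k))"
    using assms by (auto simp: X_mult[OF t] S_add skew_const_def split: nat.split)
qed

lemma horner_coeff:
  assumes "\<alpha> \<in> carrier B" "t \<in> carrier S"
  shows "(const \<alpha> \<oplus>\<^bsub>S\<^esub> X \<otimes>\<^bsub>S\<^esub> t) n = (case n of 0 \<Rightarrow> \<alpha> | Suc k \<Rightarrow> t k)"
  using assms by (auto simp: X_mult S_add skew_const_def split: nat.split)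

lemma horner_induct [consumes 1, case_names zero step]:
  assumes p: "p \<in> carrier S"
    and zero: "P \<zero>\<^bsub>S\<^esub>"
    and step: "\<And>\<alpha> t. \<alpha> \<in> carrier B \<Longrightarrow> t \<in> carrier S \<Longrightarrow> P t \<Longrightarrow> P (const \<alpha> \<oplus>\<^bsub>S\<^esub> X \<otimes>\<^bsub>S\<^esub> t)"
  shows "P p"
proof -
  obtain N where "\<forall>k\<ge>N. p k = \<zero>" using p by (auto simp: mem_S)
  then show ?thesis using p
  proof (induction N arbitrary: p)
    case 0
    then have "p = \<zero>\<^bsub>S\<^esub>" by (auto simp: S_zero)
    then show ?case using zero by simp
  next
    case (Suc N)
    have "P (\<lambda>k. p (Suc k))"
      using Suc skew_poly_decomp(1) by auto
    then show ?case
      using step skew_poly_decomp[OF Suc.prems(2)] Suc.prems(2) by (metis coeff_closed)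
  qed
qed

lemma S_abelian: "abelian_group S"
proof (rule abelian_groupI)
  show "\<exists>q\<in>carrier S. q \<oplus>\<^bsub>S\<^esub> p = \<zero>\<^bsub>S\<^esub>" if "p \<in> carrier S" for p
  proof
    show "(\<lambda>n. \<ominus> p n) \<oplus>\<^bsub>S\<^esub> p = \<zero>\<^bsub>S\<^esub>" using that by (simp add: S_add S_zero l_neg)
    show "(\<lambda>n. \<ominus> p n) \<in> carrier S" using that unfolding mem_S by (metis a_inv_closed minus_zero)
  qed
  show "\<zero>\<^bsub>S\<^esub> \<in> carrier S" by (auto simp: mem_S S_zero)
qed (auto simp: S_add_closed, auto simp: S_add S_zero a_ac fun_eq_iff)

lemma S_l_distr:
  assumes "p \<in> carrier S" "q \<in> carrier S" "r \<in> carrier S"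
  shows "(p \<oplus>\<^bsub>S\<^esub> q) \<otimes>\<^bsub>S\<^esub> r = p \<otimes>\<^bsub>S\<^esub> r \<oplus>\<^bsub>S\<^esub> q \<otimes>\<^bsub>S\<^esub> r"
proof
  fix n
  have "((p \<oplus>\<^bsub>S\<^esub> q) \<otimes>\<^bsub>S\<^esub> r) n = (\<Oplus>i\<in>{..n}. (\<rho> ^^ (n - i)) (p i) \<otimes> r (n - i)
      \<oplus> (\<rho> ^^ (n - i)) (q i) \<otimes> r (n - i))"
    unfolding S_mult using assms by (intro finsum_cong') (auto simp: S_add l_distr)
  also have "\<dots> = (p \<otimes>\<^bsub>S\<^esub> r \<oplus>\<^bsub>S\<^esub> q \<otimes>\<^bsub>S\<^esub> r) n"
    using assms by (subst finsum_addf) (auto simp: S_add S_mult)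
  finally show "((p \<oplus>\<^bsub>S\<^esub> q) \<otimes>\<^bsub>S\<^esub> r) n = (p \<otimes>\<^bsub>S\<^esub> r \<oplus>\<^bsub>S\<^esub> q \<otimes>\<^bsub>S\<^esub> r) n" .
qed

lemma S_r_distr:
  assumes "p \<in> carrier S" "q \<in> carrier S" "r \<in> carrier S"
  shows "r \<otimes>\<^bsub>S\<^esub> (p \<oplus>\<^bsub>S\<^esub> q) = r \<otimes>\<^bsub>S\<^esub> p \<oplus>\<^bsub>S\<^esub> r \<otimes>\<^bsub>S\<^esub> q"
proof
  fix n
  have "(r \<otimes>\<^bsub>S\<^esub> (p \<oplus>\<^bsub>S\<^esub> q)) n = (\<Oplus>i\<in>{..n}. (\<rho> ^^ (n - i)) (r i) \<otimes> p (n - i)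
      \<oplus> (\<rho> ^^ (n - i)) (r i) \<otimes> q (n - i))"
    unfolding S_mult using assms by (intro finsum_cong') (auto simp: S_add r_distr)
  also have "\<dots> = (r \<otimes>\<^bsub>S\<^esub> p \<oplus>\<^bsub>S\<^esub> r \<otimes>\<^bsub>S\<^esub> q) n"
    using assms by (subst finsum_addf) (auto simp: S_add S_mult)
  finally show "(r \<otimes>\<^bsub>S\<^esub> (p \<oplus>\<^bsub>S\<^esub> q)) n = (r \<otimes>\<^bsub>S\<^esub> p \<oplus>\<^bsub>S\<^esub> r \<otimes>\<^bsub>S\<^esub> q) n" .
qed

lemma X_mult_assoc:
  assumes "p \<in> carrier S" "q \<in> carrier S"
  shows "(X \<otimes>\<^bsub>S\<^esub> p) \<otimes>\<^bsub>S\<^esub> q = X \<otimes>\<^bsub>S\<^esub> (p \<otimes>\<^bsub>S\<^esub> q)"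
proof
  fix n
  show "((X \<otimes>\<^bsub>S\<^esub> p) \<otimes>\<^bsub>S\<^esub> q) n = (X \<otimes>\<^bsub>S\<^esub> (p \<otimes>\<^bsub>S\<^esub> q)) n"
  proof (cases n)
    case 0
    then show ?thesis using assms by (simp add: S_mult X_mult S_mult_closed)
  next
    case (Suc k)
    define r where "r = X \<otimes>\<^bsub>S\<^esub> p"
    have r: "r 0 = \<zero>" "\<And>i. r (Suc i) = p i" "\<And>i. r i \<in> carrier B"
      using assms by (simp_all add: r_def X_mult split: nat.split)
    have "(r \<otimes>\<^bsub>S\<^esub> q) (Suc k)
        = (\<Oplus>i\<in>{..k}. (\<rho> ^^ (k - i)) (p i) \<otimes> q (k - i)) \<oplus> (\<rho> ^^ Suc k) \<zero> \<otimes> q (Suc k)"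
      unfolding S_mult using assms r
      by (subst add.finprod_Suc2) (auto simp del: funpow.simps)
    also have "\<dots> = (p \<otimes>\<^bsub>S\<^esub> q) k"
      using assms unfolding rho_pow_zero by (simp add: S_mult)
    finally show ?thesis using assms Suc by (simp add: r_def X_mult[of "p \<otimes>\<^bsub>S\<^esub> q"] S_mult_closed)
  qed
qed

lemma const_mult_assoc:
  assumes "\<alpha> \<in> carrier B" "p \<in> carrier S" "q \<in> carrier S"
  shows "(const \<alpha> \<otimes>\<^bsub>S\<^esub> p) \<otimes>\<^bsub>S\<^esub> q = const \<alpha> \<otimes>\<^bsub>S\<^esub> (p \<otimes>\<^bsub>S\<^esub> q)"
proof
  fix n
  have "((const \<alpha> \<otimes>\<^bsub>S\<^esub> p) \<otimes>\<^bsub>S\<^esub> q) n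
      = (\<Oplus>i\<in>{..n}. (\<rho> ^^ n) \<alpha> \<otimes> ((\<rho> ^^ (n - i)) (p i) \<otimes> q (n - i)))"
    unfolding S_mult[of "const \<alpha> \<otimes>\<^bsub>S\<^esub> p" q]
  proof (intro finsum_cong')
    fix i assume i: "i \<in> {..n}"
    have "(\<rho> ^^ (n - i)) ((\<rho> ^^ i) \<alpha>) = (\<rho> ^^ n) \<alpha>"
      using i rho_pow_rho_pow[of "n - i" i] by simp
    then show "(\<rho> ^^ (n - i)) ((const \<alpha> \<otimes>\<^bsub>S\<^esub> p) i) \<otimes> q (n - i)
        = (\<rho> ^^ n) \<alpha> \<otimes> ((\<rho> ^^ (n - i)) (p i) \<otimes> q (n - i))"
      using assms by (simp add: const_mult m_assoc)
  qed (use assms in auto)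
  also have "\<dots> = (const \<alpha> \<otimes>\<^bsub>S\<^esub> (p \<otimes>\<^bsub>S\<^esub> q)) n"
    using assms by (subst finsum_rdistr[symmetric]) (auto simp: const_mult S_mult_closed S_mult)
  finally show "((const \<alpha> \<otimes>\<^bsub>S\<^esub> p) \<otimes>\<^bsub>S\<^esub> q) n = (const \<alpha> \<otimes>\<^bsub>S\<^esub> (p \<otimes>\<^bsub>S\<^esub> q)) n" .
qed

lemma zero_mult_S: "q \<in> carrier S \<Longrightarrow> \<zero>\<^bsub>S\<^esub> \<otimes>\<^bsub>S\<^esub> q = \<zero>\<^bsub>S\<^esub>"
  by (rule ext) (auto simp: S_mult S_zero intro!: add.finprod_one_eqI)

lemma S_assoc:
  assumes "p \<in> carrier S" "q \<in> carrier S" "r \<in> carrier S"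
  shows "(p \<otimes>\<^bsub>S\<^esub> q) \<otimes>\<^bsub>S\<^esub> r = p \<otimes>\<^bsub>S\<^esub> (q \<otimes>\<^bsub>S\<^esub> r)"
  using assms
proof (induction p rule: horner_induct)
  case zero
  then show ?case by (simp add: zero_mult_S S_mult_closed)
next
  case (step \<alpha> t)
  then show ?case
    by (simp add: S_l_distr S_mult_closed const_mult_assoc X_mult_assoc)
qed

lemma S_ring: "ring S"
proof (rule ringI[OF S_abelian])
  show "monoid S"
  proof (rule monoidI)
    show "\<one>\<^bsub>S\<^esub> \<otimes>\<^bsub>S\<^esub> p = p" "p \<otimes>\<^bsub>S\<^esub> \<one>\<^bsub>S\<^esub> = p" if "p \<in> carrier S" for p
      using that by (simp_all add: S_one const_mult mult_const)
  qed (simp_all add: S_mult_closed S_assoc S_one)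
qed (simp_all add: S_l_distr S_r_distr)

sublocale S: ring S by (rule S_ring)

text \<open>The extension of \<open>\<rho>\<close> to \<open>S\<close> acts on coefficients.  The relation \<open>p X = X \<rho>(p)\<close> determines it,
  because \<open>X\<close> is left cancellable, and multiplicativity then follows from associativity.\<close>

definition S_rho :: "(nat \<Rightarrow> 'a) \<Rightarrow> nat \<Rightarrow> 'a" where
  "S_rho p = (\<lambda>k. \<rho> (p k))"

lemma S_rho_closed [simp]: "p \<in> carrier S \<Longrightarrow> S_rho p \<in> carrier S"
  unfolding mem_S S_rho_def by (metis rho_closed rho_zero)

lemma S_rho_add: "p \<in> carrier S \<Longrightarrow> q \<in> carrier S \<Longrightarrow> S_rho (p \<oplus>\<^bsub>S\<^esub> q) = S_rho p \<oplus>\<^bsub>S\<^esub> S_rho q"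
  by (simp add: S_rho_def S_add)

lemma const_mult_X: "\<alpha> \<in> carrier B \<Longrightarrow> const \<alpha> \<otimes>\<^bsub>S\<^esub> X = X \<otimes>\<^bsub>S\<^esub> const (\<rho> \<alpha>)"
  by (rule skew_const_mult_X[OF ring_axioms rho_iso])

lemma mult_X: "p \<in> carrier S \<Longrightarrow> p \<otimes>\<^bsub>S\<^esub> X = X \<otimes>\<^bsub>S\<^esub> S_rho p"
proof (induction p rule: horner_induct)
  case zero
  then show ?case by (simp add: S_rho_def S_zero[symmetric] S_zero[THEN fun_cong])
next
  case (step \<alpha> t)
  have "S_rho (const \<alpha> \<oplus>\<^bsub>S\<^esub> X \<otimes>\<^bsub>S\<^esub> t) = const (\<rho> \<alpha>) \<oplus>\<^bsub>S\<^esub> X \<otimes>\<^bsub>S\<^esub> S_rho t"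
    using step(1,2) by (intro ext) (auto simp: horner_coeff S_rho_def[of "_ \<oplus>\<^bsub>S\<^esub> _"], auto simp: S_rho_def split: nat.split)
  then show ?case
    using step by (simp add: S.l_distr S.r_distr const_mult_X S.m_assoc)
qed

lemma X_cancel: "X \<otimes>\<^bsub>S\<^esub> p = X \<otimes>\<^bsub>S\<^esub> q \<Longrightarrow> p \<in> carrier S \<Longrightarrow> q \<in> carrier S \<Longrightarrow> p = q"
  by (rule ext) (metis X_mult nat.case(2))

lemma S_rho_mult:
  assumes "p \<in> carrier S" "q \<in> carrier S"
  shows "S_rho (p \<otimes>\<^bsub>S\<^esub> q) = S_rho p \<otimes>\<^bsub>S\<^esub> S_rho q"
proof (rule X_cancel)
  have "X \<otimes>\<^bsub>S\<^esub> S_rho (p \<otimes>\<^bsub>S\<^esub> q) = p \<otimes>\<^bsub>S\<^esub> (q \<otimes>\<^bsub>S\<^esub> X)"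
    using assms by (simp add: mult_X[symmetric] S.m_assoc)
  also have "\<dots> = (p \<otimes>\<^bsub>S\<^esub> X) \<otimes>\<^bsub>S\<^esub> S_rho q"
    using assms by (simp add: mult_X[of q] S.m_assoc)
  also have "\<dots> = X \<otimes>\<^bsub>S\<^esub> (S_rho p \<otimes>\<^bsub>S\<^esub> S_rho q)"
    using assms by (simp add: mult_X[of p] S.m_assoc)
  finally show "X \<otimes>\<^bsub>S\<^esub> S_rho (p \<otimes>\<^bsub>S\<^esub> q) = X \<otimes>\<^bsub>S\<^esub> (S_rho p \<otimes>\<^bsub>S\<^esub> S_rho q)" .
qed (use assms in simp_all)

lemma X_pow_mult_const:
  "\<alpha> \<in> carrier B \<Longrightarrow> (X [^]\<^bsub>S\<^esub> n) \<otimes>\<^bsub>S\<^esub> const \<alpha> = (\<lambda>k. if k = n then \<alpha> else \<zero>)"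
proof (induction n)
  case 0
  then show ?case by simp (auto simp: skew_const_def)
next
  case (Suc n)
  have "(X [^]\<^bsub>S\<^esub> Suc n) \<otimes>\<^bsub>S\<^esub> const \<alpha> = X \<otimes>\<^bsub>S\<^esub> ((X [^]\<^bsub>S\<^esub> n) \<otimes>\<^bsub>S\<^esub> const \<alpha>)"
    using Suc by (simp add: S.nat_pow_Suc2 S.m_assoc del: Group.nat_pow_Suc S.nat_pow_Suc)
  also have "\<dots> = (\<lambda>k. case k of 0 \<Rightarrow> \<zero> | Suc j \<Rightarrow> ((X [^]\<^bsub>S\<^esub> n) \<otimes>\<^bsub>S\<^esub> const \<alpha>) j)"
    using Suc.prems by (intro X_mult) simp
  also have "\<dots> = (\<lambda>k. if k = Suc n then \<alpha> else \<zero>)"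
    using Suc by (auto split: nat.split)
  finally show ?case .
qed

definition truncate :: "nat \<Rightarrow> (nat \<Rightarrow> 'a) \<Rightarrow> nat \<Rightarrow> 'a" where
  "truncate n c = (\<lambda>k. if k < n then c k else \<zero>)"

lemma truncate_closed: "c \<in> {..<n} \<rightarrow> carrier B \<Longrightarrow> truncate n c \<in> carrier S"
  by (auto simp: mem_S truncate_def intro!: exI[of _ n])

lemma truncate_Suc:
  assumes "c \<in> {..<Suc n} \<rightarrow> carrier B"
  shows "truncate (Suc n) c = truncate n c \<oplus>\<^bsub>S\<^esub> (X [^]\<^bsub>S\<^esub> n) \<otimes>\<^bsub>S\<^esub> const (c n)"
  using assms by (auto simp: X_pow_mult_const S_add truncate_def fun_eq_iff less_Suc_eq Pi_def)

end

section \<open>Derivations along a homomorphism\<close>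

text \<open>The map \<open>D\<close> below is the unique derivation from \<open>S\<close> to \<open>A\<close> along \<open>\<pi>\<close> that kills the
  constants and sends \<open>X\<close> to \<open>g\<close>.  The hypothesis on \<open>g\<close> is forced: it is what applying a
  derivation to \<open>\<alpha> X = X \<rho>(\<alpha>)\<close> yields.\<close>

locale skew_derivation = skew_poly B \<rho> + A: ring A
  for B :: "('a, 'm) ring_scheme" (structure) and \<rho> and A :: "('c, 'n) ring_scheme" +
  fixes \<pi> :: "(nat \<Rightarrow> 'a) \<Rightarrow> 'c" and g :: 'c
  assumes pi_hom: "\<pi> \<in> ring_hom (skew_poly_ring B \<rho>) A"
    and g_closed [simp]: "g \<in> carrier A"
    and g_comm: "\<alpha> \<in> carrier B \<Longrightarrow>
      \<pi> (skew_const B \<alpha>) \<otimes>\<^bsub>A\<^esub> g = g \<otimes>\<^bsub>A\<^esub> \<pi> (skew_const B (\<rho> \<alpha>))"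
begin

lemma pi_closed [simp]: "p \<in> carrier S \<Longrightarrow> \<pi> p \<in> carrier A"
  and pi_add [simp]: "p \<in> carrier S \<Longrightarrow> q \<in> carrier S \<Longrightarrow> \<pi> (p \<oplus>\<^bsub>S\<^esub> q) = \<pi> p \<oplus>\<^bsub>A\<^esub> \<pi> q"
  and pi_mult [simp]: "p \<in> carrier S \<Longrightarrow> q \<in> carrier S \<Longrightarrow> \<pi> (p \<otimes>\<^bsub>S\<^esub> q) = \<pi> p \<otimes>\<^bsub>A\<^esub> \<pi> q"
  and pi_one [simp]: "\<pi> \<one>\<^bsub>S\<^esub> = \<one>\<^bsub>A\<^esub>"
  and pi_zero [simp]: "\<pi> \<zero>\<^bsub>S\<^esub> = \<zero>\<^bsub>A\<^esub>"
  using ring_hom_memE[OF pi_hom] ring_hom_zero[OF pi_hom S_ring A.ring_axioms] by auto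

text \<open>Horner recursion: the Leibniz rule gives \<open>D(\<alpha> + X t) = g t + x D(t)\<close>.  The first argument
  is fuel, to be chosen above the degree.\<close>

primrec D_rec :: "nat \<Rightarrow> (nat \<Rightarrow> 'a) \<Rightarrow> 'c" where
  "D_rec 0 p = \<zero>\<^bsub>A\<^esub>"
| "D_rec (Suc n) p = g \<otimes>\<^bsub>A\<^esub> \<pi> (\<lambda>k. p (Suc k)) \<oplus>\<^bsub>A\<^esub> \<pi> X \<otimes>\<^bsub>A\<^esub> D_rec n (\<lambda>k. p (Suc k))"

definition D :: "(nat \<Rightarrow> 'a) \<Rightarrow> 'c" where
  "D p = D_rec (LEAST N. \<forall>k\<ge>N. p k = \<zero>) p"

lemma D_rec_closed: "p \<in> carrier S \<Longrightarrow> D_rec n p \<in> carrier A"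
  by (induction n arbitrary: p) (simp_all add: skew_poly_decomp(1))

lemma D_rec_zero: "D_rec n \<zero>\<^bsub>S\<^esub> = \<zero>\<^bsub>A\<^esub>"
proof (induction n)
  case (Suc n)
  have "(\<lambda>k. \<zero>\<^bsub>S\<^esub> (Suc k)) = \<zero>\<^bsub>S\<^esub>" by (simp add: S_zero)
  then show ?case using Suc by simp
qed simp

lemma D_rec_stable:
  "p \<in> carrier S \<Longrightarrow> \<forall>k\<ge>N. p k = \<zero> \<Longrightarrow> N \<le> M \<Longrightarrow> D_rec M p = D_rec N p"
proof (induction N arbitrary: p M)
  case 0
  then have "p = \<zero>\<^bsub>S\<^esub>" by (auto simp: S_zero)
  then show ?case by (simp add: D_rec_zero)
next
  case (Suc N)
  obtain M' where M: "M = Suc M'" "N \<le> M'" using Suc.prems(3) by (cases M) auto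
  have "D_rec M' (\<lambda>k. p (Suc k)) = D_rec N (\<lambda>k. p (Suc k))"
    using Suc.prems(2) by (intro Suc.IH[OF skew_poly_decomp(1)[OF Suc.prems(1)] _ M(2)]) simp
  then show ?case using M by simp
qed

lemma D_eq:
  assumes "p \<in> carrier S" "\<forall>k\<ge>N. p k = \<zero>"
  shows "D p = D_rec N p"
proof -
  let ?P = "\<lambda>N. \<forall>k\<ge>N. p k = \<zero>"
  have "?P (LEAST N. ?P N)" and "(LEAST N. ?P N) \<le> N"
    using assms(2) by (rule LeastI[of ?P], rule Least_le[of ?P])
  then show ?thesis
    unfolding D_def by (rule D_rec_stable[OF assms(1), symmetric])
qed

lemma D_closed [simp]:
  assumes "p \<in> carrier S"
  shows "D p \<in> carrier A"
  unfolding D_def using assms by (rule D_rec_closed)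

lemma D_horner:
  assumes "\<alpha> \<in> carrier B" "t \<in> carrier S"
  shows "D (const \<alpha> \<oplus>\<^bsub>S\<^esub> X \<otimes>\<^bsub>S\<^esub> t) = g \<otimes>\<^bsub>A\<^esub> \<pi> t \<oplus>\<^bsub>A\<^esub> \<pi> X \<otimes>\<^bsub>A\<^esub> D t"
proof -
  obtain N where N: "\<forall>k\<ge>N. t k = \<zero>" using assms by (auto simp: mem_S)
  then have "\<forall>k\<ge>Suc N. (const \<alpha> \<oplus>\<^bsub>S\<^esub> X \<otimes>\<^bsub>S\<^esub> t) k = \<zero>"
    using assms by (auto simp: horner_coeff split: nat.split)
  then have "D (const \<alpha> \<oplus>\<^bsub>S\<^esub> X \<otimes>\<^bsub>S\<^esub> t) = D_rec (Suc N) (const \<alpha> \<oplus>\<^bsub>S\<^esub> X \<otimes>\<^bsub>S\<^esub> t)"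
    using assms by (intro D_eq) simp_all
  then show ?thesis using assms N by (simp add: horner_coeff D_eq[of t N])
qed

lemma D_zero [simp]: "D \<zero>\<^bsub>S\<^esub> = \<zero>\<^bsub>A\<^esub>"
  by (simp add: D_def D_rec_zero)

lemma D_const [simp]: "\<alpha> \<in> carrier B \<Longrightarrow> D (const \<alpha>) = \<zero>\<^bsub>A\<^esub>"
  using D_horner[of \<alpha> "\<zero>\<^bsub>S\<^esub>"] by simp

lemma D_X_mult: "t \<in> carrier S \<Longrightarrow> D (X \<otimes>\<^bsub>S\<^esub> t) = g \<otimes>\<^bsub>A\<^esub> \<pi> t \<oplus>\<^bsub>A\<^esub> \<pi> X \<otimes>\<^bsub>A\<^esub> D t"
  using D_horner[of \<zero> t] by (simp add: const_zero)

lemma D_X [simp]: "D X = g"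
  using D_X_mult[of "\<one>\<^bsub>S\<^esub>"] D_const[of \<one>] by (simp add: S_one[symmetric])

lemma D_rec_add:
  "p \<in> carrier S \<Longrightarrow> q \<in> carrier S \<Longrightarrow> D_rec n (p \<oplus>\<^bsub>S\<^esub> q) = D_rec n p \<oplus>\<^bsub>A\<^esub> D_rec n q"
proof (induction n arbitrary: p q)
  case (Suc n)
  let ?p = "\<lambda>k. p (Suc k)" and ?q = "\<lambda>k. q (Suc k)"
  have "(\<lambda>k. (p \<oplus>\<^bsub>S\<^esub> q) (Suc k)) = ?p \<oplus>\<^bsub>S\<^esub> ?q" by (simp add: S_add)
  moreover have "?p \<in> carrier S" "?q \<in> carrier S" using Suc skew_poly_decomp(1) by auto
  ultimately show ?case
    using Suc.IH[of ?p ?q] by (simp add: A.r_distr D_rec_closed A.a_ac)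
qed simp

lemma D_add:
  assumes "p \<in> carrier S" "q \<in> carrier S"
  shows "D (p \<oplus>\<^bsub>S\<^esub> q) = D p \<oplus>\<^bsub>A\<^esub> D q"
proof -
  obtain N M where N: "\<forall>k\<ge>N. p k = \<zero>" and M: "\<forall>k\<ge>M. q k = \<zero>"
    using assms by (auto simp: mem_S)
  have "D p = D_rec (N + M) p" "D q = D_rec (N + M) q" "D (p \<oplus>\<^bsub>S\<^esub> q) = D_rec (N + M) (p \<oplus>\<^bsub>S\<^esub> q)"
    using assms N M by (intro D_eq S.a_closed; auto simp: S_add)+
  then show ?thesis using assms by (simp add: D_rec_add)
qed

lemma pi_const_mult_pi_X:
  "\<alpha> \<in> carrier B \<Longrightarrow> \<pi> (const \<alpha>) \<otimes>\<^bsub>A\<^esub> \<pi> X = \<pi> X \<otimes>\<^bsub>A\<^esub> \<pi> (const (\<rho> \<alpha>))"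
  by (simp add: const_mult_X flip: pi_mult)

text \<open>Moving \<open>\<alpha>\<close> past the leading \<open>X\<close> replaces it by \<open>\<rho>(\<alpha>)\<close>; as \<open>g\<close> and \<open>x\<close> both commute with
  constants up to \<open>\<rho>\<close>, the two summands of the Horner recursion give \<open>\<alpha>\<close> back on the left.\<close>

lemma D_const_mult:
  assumes "p \<in> carrier S" "\<alpha> \<in> carrier B"
  shows "D (const \<alpha> \<otimes>\<^bsub>S\<^esub> p) = \<pi> (const \<alpha>) \<otimes>\<^bsub>A\<^esub> D p"
  using assms
proof (induction p arbitrary: \<alpha> rule: horner_induct)
  case zero
  then show ?case by simp
next
  case (step \<beta> t)
  have eq: "const \<alpha> \<otimes>\<^bsub>S\<^esub> (const \<beta> \<oplus>\<^bsub>S\<^esub> X \<otimes>\<^bsub>S\<^esub> t)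
      = const (\<alpha> \<otimes> \<beta>) \<oplus>\<^bsub>S\<^esub> X \<otimes>\<^bsub>S\<^esub> (const (\<rho> \<alpha>) \<otimes>\<^bsub>S\<^esub> t)"
    using step by (simp add: S.r_distr const_mult_const const_mult_X flip: S.m_assoc)
  have "D (const \<alpha> \<otimes>\<^bsub>S\<^esub> (const \<beta> \<oplus>\<^bsub>S\<^esub> X \<otimes>\<^bsub>S\<^esub> t))
      = g \<otimes>\<^bsub>A\<^esub> \<pi> (const (\<rho> \<alpha>)) \<otimes>\<^bsub>A\<^esub> \<pi> t \<oplus>\<^bsub>A\<^esub> \<pi> X \<otimes>\<^bsub>A\<^esub> \<pi> (const (\<rho> \<alpha>)) \<otimes>\<^bsub>A\<^esub> D t"
    unfolding eq using step by (subst D_horner) (simp_all add: A.m_assoc)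
  also have "\<dots> = \<pi> (const \<alpha>) \<otimes>\<^bsub>A\<^esub> (g \<otimes>\<^bsub>A\<^esub> \<pi> t \<oplus>\<^bsub>A\<^esub> \<pi> X \<otimes>\<^bsub>A\<^esub> D t)"
    using step by (simp add: A.r_distr A.m_assoc flip: g_comm pi_const_mult_pi_X)
  finally show ?case using step by (simp add: D_horner)
qed

lemma D_mult:
  assumes "p \<in> carrier S" "q \<in> carrier S"
  shows "D (p \<otimes>\<^bsub>S\<^esub> q) = D p \<otimes>\<^bsub>A\<^esub> \<pi> q \<oplus>\<^bsub>A\<^esub> \<pi> p \<otimes>\<^bsub>A\<^esub> D q"
  using assms
proof (induction p rule: horner_induct)
  case zero
  then show ?case by simp
next
  case (step \<alpha> t)
  have "D ((const \<alpha> \<oplus>\<^bsub>S\<^esub> X \<otimes>\<^bsub>S\<^esub> t) \<otimes>\<^bsub>S\<^esub> q) = D (const \<alpha> \<otimes>\<^bsub>S\<^esub> q) \<oplus>\<^bsub>A\<^esub> D (X \<otimes>\<^bsub>S\<^esub> (t \<otimes>\<^bsub>S\<^esub> q))"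
    using step by (simp add: S.l_distr S.m_assoc D_add)
  also have "\<dots> = \<pi> (const \<alpha>) \<otimes>\<^bsub>A\<^esub> D q
      \<oplus>\<^bsub>A\<^esub> (g \<otimes>\<^bsub>A\<^esub> (\<pi> t \<otimes>\<^bsub>A\<^esub> \<pi> q) \<oplus>\<^bsub>A\<^esub> \<pi> X \<otimes>\<^bsub>A\<^esub> (D t \<otimes>\<^bsub>A\<^esub> \<pi> q \<oplus>\<^bsub>A\<^esub> \<pi> t \<otimes>\<^bsub>A\<^esub> D q))"
    using step by (simp add: D_const_mult D_X_mult)
  also have "\<dots> = (g \<otimes>\<^bsub>A\<^esub> \<pi> t \<oplus>\<^bsub>A\<^esub> \<pi> X \<otimes>\<^bsub>A\<^esub> D t) \<otimes>\<^bsub>A\<^esub> \<pi> q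
      \<oplus>\<^bsub>A\<^esub> (\<pi> (const \<alpha>) \<oplus>\<^bsub>A\<^esub> \<pi> X \<otimes>\<^bsub>A\<^esub> \<pi> t) \<otimes>\<^bsub>A\<^esub> D q"
    using step by (simp add: A.r_distr A.l_distr A.m_assoc A.a_ac)
  finally show ?case using step by (simp add: D_horner)
qed

text \<open>Uniqueness: constants and \<open>X\<close> generate \<open>S\<close>, so a derivation of \<open>A\<close> that kills the images of
  constants is determined by its value at the image of \<open>X\<close>.\<close>

lemma derivation_eq_D:
  assumes add: "\<And>y z. y \<in> carrier A \<Longrightarrow> z \<in> carrier A \<Longrightarrow> \<delta> (y \<oplus>\<^bsub>A\<^esub> z) = \<delta> y \<oplus>\<^bsub>A\<^esub> \<delta> z"
    and mult: "\<And>y z. y \<in> carrier A \<Longrightarrow> z \<in> carrier A \<Longrightarrow>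
      \<delta> (y \<otimes>\<^bsub>A\<^esub> z) = \<delta> y \<otimes>\<^bsub>A\<^esub> z \<oplus>\<^bsub>A\<^esub> y \<otimes>\<^bsub>A\<^esub> \<delta> z"
    and const: "\<And>\<alpha>. \<alpha> \<in> carrier B \<Longrightarrow> \<delta> (\<pi> (const \<alpha>)) = \<zero>\<^bsub>A\<^esub>"
    and X: "\<delta> (\<pi> X) = g"
    and p: "p \<in> carrier S"
  shows "\<delta> (\<pi> p) = D p"
  using p
proof (induction p rule: horner_induct)
  case zero
  then show ?case using const[of \<zero>] by (simp add: const_zero)
next
  case (step \<alpha> t)
  then show ?case by (simp add: D_horner add mult const X)
qed

text \<open>When \<open>g x^k = x^k (G k)\<close>, all powers of \<open>x\<close> in \<open>D(X^(k + 1)) = \<Sum>j\<le>k. x^(k - j) g x^j\<close> can be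
  collected on the left.  In \<open>A\<close> the elements \<open>G k\<close> will be the iterates of \<open>\<rho>\<close> at \<open>g\<close>.\<close>

lemma D_X_pow:
  assumes shift: "\<And>k. g \<otimes>\<^bsub>A\<^esub> (\<pi> X [^]\<^bsub>A\<^esub> k) = (\<pi> X [^]\<^bsub>A\<^esub> k) \<otimes>\<^bsub>A\<^esub> G k"
    and G: "\<And>k. G k \<in> carrier A"
  shows "D (X [^]\<^bsub>S\<^esub> Suc k) = (\<pi> X [^]\<^bsub>A\<^esub> k) \<otimes>\<^bsub>A\<^esub> (\<Oplus>\<^bsub>A\<^esub>j\<in>{..k}. G j)"
proof (induction k)
  case 0
  have "G 0 = g" using shift[of 0] G by simp
  then show ?case using G[of 0] D_X by (simp add: Pi_def)
next
  case (Suc k)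
  have pow: "\<pi> (X [^]\<^bsub>S\<^esub> n) = \<pi> X [^]\<^bsub>A\<^esub> n" for n :: nat
    by (induction n) simp_all
  have "D (X [^]\<^bsub>S\<^esub> Suc (Suc k)) = g \<otimes>\<^bsub>A\<^esub> (\<pi> X [^]\<^bsub>A\<^esub> Suc k) \<oplus>\<^bsub>A\<^esub> \<pi> X \<otimes>\<^bsub>A\<^esub> D (X [^]\<^bsub>S\<^esub> Suc k)"
    by (simp only: S.nat_pow_Suc2[of X "Suc k"] X_closed D_X_mult S.nat_pow_closed pow)
  also have "\<dots> = (\<pi> X [^]\<^bsub>A\<^esub> Suc k) \<otimes>\<^bsub>A\<^esub> G (Suc k)
      \<oplus>\<^bsub>A\<^esub> (\<pi> X [^]\<^bsub>A\<^esub> Suc k) \<otimes>\<^bsub>A\<^esub> (\<Oplus>\<^bsub>A\<^esub>j\<in>{..k}. G j)"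
  proof -
    have "\<pi> X \<otimes>\<^bsub>A\<^esub> ((\<pi> X [^]\<^bsub>A\<^esub> k) \<otimes>\<^bsub>A\<^esub> s) = (\<pi> X [^]\<^bsub>A\<^esub> Suc k) \<otimes>\<^bsub>A\<^esub> s" if "s \<in> carrier A" for s
      unfolding A.nat_pow_Suc2[OF pi_closed[OF X_closed]] using that by (simp add: A.m_assoc)
    then show ?thesis using G by (simp only: shift[of "Suc k"] Suc.IH) simp
  qed
  finally show ?case
    using G by (simp add: A.r_distr del: Group.nat_pow_Suc A.nat_pow_Suc S.nat_pow_Suc)
qed

lemma D_truncate:
  assumes "c \<in> {..<Suc N} \<rightarrow> carrier B"
  shows "D (truncate (Suc N) c) = (\<Oplus>\<^bsub>A\<^esub>k\<in>{..<N}. D (X [^]\<^bsub>S\<^esub> Suc k) \<otimes>\<^bsub>A\<^esub> \<pi> (const (c (Suc k))))"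
  using assms
proof (induction N)
  case 0
  have "truncate (Suc 0) c = const (c 0)" by (auto simp: truncate_def skew_const_def)
  then show ?case using 0 by (simp add: Pi_def)
next
  case (Suc N)
  have c: "\<And>k. k \<le> Suc N \<Longrightarrow> c k \<in> carrier B" using Suc.prems by auto
  have "D (truncate (Suc (Suc N)) c) = D (truncate (Suc N) c)
      \<oplus>\<^bsub>A\<^esub> D ((X [^]\<^bsub>S\<^esub> Suc N) \<otimes>\<^bsub>S\<^esub> const (c (Suc N)))"
    using c by (subst truncate_Suc) (auto intro!: D_add truncate_closed)
  moreover have "D ((X [^]\<^bsub>S\<^esub> Suc N) \<otimes>\<^bsub>S\<^esub> const (c (Suc N))) = D (X [^]\<^bsub>S\<^esub> Suc N) \<otimes>\<^bsub>A\<^esub> \<pi> (const (c (Suc N)))"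
    using c by (subst D_mult) (simp_all del: Group.nat_pow_Suc S.nat_pow_Suc)
  moreover have "D (truncate (Suc N) c)
      = (\<Oplus>\<^bsub>A\<^esub>k\<in>{..<N}. D (X [^]\<^bsub>S\<^esub> Suc k) \<otimes>\<^bsub>A\<^esub> \<pi> (const (c (Suc k))))"
    using Suc.IH c by auto
  ultimately show ?case
    using c by (simp add: lessThan_Suc A.finsum_insert Pi_def A.a_comm del: Group.nat_pow_Suc S.nat_pow_Suc)
qed

end

section \<open>The quotient ring and its derivations\<close>

locale skew_quotient = skew_poly B \<rho>
  for B :: "('a, 'm) ring_scheme" (structure) and \<rho> +
  fixes f :: "nat \<Rightarrow> 'a" and m :: nat
  assumes f_monic: "skew_monic B m f"
    and f_normal: "f \<in> skew_poly_0 B \<rho>"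
    and f_fixed: "f \<in> fixed_polys B \<rho>"
begin

abbreviation I :: "(nat \<Rightarrow> 'a) set" where "I \<equiv> skew_ideal B \<rho> f"
abbreviation A :: "(nat \<Rightarrow> 'a) set ring" where "A \<equiv> skew_quot B \<rho> f"
abbreviation \<pi> :: "(nat \<Rightarrow> 'a) \<Rightarrow> (nat \<Rightarrow> 'a) set" where "\<pi> \<equiv> (+>\<^bsub>S\<^esub>) I"
abbreviation x :: "(nat \<Rightarrow> 'a) set" where "x \<equiv> quot_x B \<rho> f"
abbreviation \<rho>A :: "(nat \<Rightarrow> 'a) set \<Rightarrow> (nat \<Rightarrow> 'a) set" where "\<rho>A \<equiv> quot_rho B \<rho> f m"
abbreviation \<tau> :: "(nat \<Rightarrow> 'a) set \<Rightarrow> (nat \<Rightarrow> 'a) set" where "\<tau> \<equiv> quot_tau B \<rho> f m"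

lemma f_closed [simp]: "f \<in> carrier S"
  using f_normal by (simp add: skew_poly_0_def)

lemma S_rho_f: "S_rho f = f"
  using f_fixed by (auto simp: fixed_polys_def fixed_elements_def S_rho_def)

lemma I_eq: "I = (\<lambda>s. f \<otimes>\<^bsub>S\<^esub> s) ` carrier S" and I_eq': "I = (\<lambda>s. s \<otimes>\<^bsub>S\<^esub> f) ` carrier S"
  using f_normal by (auto simp: skew_ideal_def skew_poly_0_def l_coset_def r_coset_def)

lemma I_ideal: "ideal I S"
proof (rule idealI[OF S_ring])
  show "subgroup I (add_monoid S)"
  proof (rule S.add.subgroupI)
    show "I \<subseteq> carrier S" "I \<noteq> {}" by (auto simp: I_eq)
    show "\<ominus>\<^bsub>S\<^esub> a \<in> I" if "a \<in> I" for a
      using that by (auto simp: I_eq simp flip: S.r_minus)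
    show "a \<oplus>\<^bsub>S\<^esub> b \<in> I" if "a \<in> I" "b \<in> I" for a b
      using that by (auto simp: I_eq simp flip: S.r_distr)
  qed
  show "a \<otimes>\<^bsub>S\<^esub> p \<in> I" if "a \<in> I" "p \<in> carrier S" for a p
    using that by (auto simp: I_eq S.m_assoc)
  show "p \<otimes>\<^bsub>S\<^esub> a \<in> I" if "a \<in> I" "p \<in> carrier S" for a p
    using that by (auto simp: I_eq' simp flip: S.m_assoc)
qed

sublocale I: ideal I S by (rule I_ideal)

sublocale A: ring A
  unfolding skew_quot_def by (rule I.quotient_is_ring)

lemma pi_hom: "\<pi> \<in> ring_hom S A"
  unfolding skew_quot_def by (rule I.rcos_ring_hom)

lemma pi_closed [simp]: "p \<in> carrier S \<Longrightarrow> \<pi> p \<in> carrier A"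
  and pi_add: "p \<in> carrier S \<Longrightarrow> q \<in> carrier S \<Longrightarrow> \<pi> (p \<oplus>\<^bsub>S\<^esub> q) = \<pi> p \<oplus>\<^bsub>A\<^esub> \<pi> q"
  and pi_mult: "p \<in> carrier S \<Longrightarrow> q \<in> carrier S \<Longrightarrow> \<pi> (p \<otimes>\<^bsub>S\<^esub> q) = \<pi> p \<otimes>\<^bsub>A\<^esub> \<pi> q"
  and pi_one: "\<pi> \<one>\<^bsub>S\<^esub> = \<one>\<^bsub>A\<^esub>"
  and pi_zero: "\<pi> \<zero>\<^bsub>S\<^esub> = \<zero>\<^bsub>A\<^esub>"
  using ring_hom_memE[OF pi_hom] ring_hom_zero[OF pi_hom S_ring A.ring_axioms] by auto

lemma quot_const_eq: "quot_const B \<rho> f \<alpha> = \<pi> (const \<alpha>)"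
  by (simp add: quot_const_def)

lemma quot_x_eq: "x = \<pi> X"
  by (simp add: quot_x_def)

lemma A_carrierE:
  assumes "y \<in> carrier A"
  obtains p where "p \<in> carrier S" "y = \<pi> p"
  using assms by (auto simp: skew_quot_def FactRing_def A_RCOSETS_def' )

lemma pi_f: "\<pi> f = \<zero>\<^bsub>A\<^esub>"
proof -
  have "f \<in> I" unfolding I_eq using S.one_closed f_closed S.r_one by (metis image_eqI)
  then show ?thesis using I.a_rcos_const pi_zero S.zero_closed I.zero_closed by metis
qed

lemma pi_eqE:
  assumes "\<pi> p = \<pi> q" "p \<in> carrier S" "q \<in> carrier S"
  obtains s where "s \<in> carrier S" "p = q \<oplus>\<^bsub>S\<^esub> f \<otimes>\<^bsub>S\<^esub> s"
proof -
  have "p \<ominus>\<^bsub>S\<^esub> q \<in> I"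
    using assms S.quotient_eq_iff_same_a_r_cos[OF I_ideal] by blast
  then obtain s where s: "s \<in> carrier S" "p \<ominus>\<^bsub>S\<^esub> q = f \<otimes>\<^bsub>S\<^esub> s"
    by (auto simp: I_eq)
  have "q \<oplus>\<^bsub>S\<^esub> (p \<ominus>\<^bsub>S\<^esub> q) = p"
    using assms by (simp add: S.minus_eq S.a_lcomm S.r_neg)
  then show thesis using that s by metis
qed

text \<open>Division with remainder by the monic \<open>f\<close>, so that \<open>1, x, \<dots>, x^(m - 1)\<close> span \<open>A\<close>.  In Horner
  form each step raises the degree by one, hence at most the single coefficient at \<open>X^m\<close> has to be
  removed, and subtracting \<open>f (r m)\<close> removes it without any shift.\<close>

lemma division:
  assumes "p \<in> carrier S"
  shows "\<exists>q\<in>carrier S. (\<forall>k\<ge>m. q k = \<zero>) \<and> \<pi> p = \<pi> q"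
  using assms
proof (induction p rule: horner_induct)
  case zero
  then show ?case by (intro bexI[of _ "\<zero>\<^bsub>S\<^esub>"] S.zero_closed) (simp add: S_zero)
next
  case (step \<alpha> t)
  then obtain q where q: "q \<in> carrier S" "\<forall>k\<ge>m. q k = \<zero>" "\<pi> t = \<pi> q" by auto
  define r where "r = const \<alpha> \<oplus>\<^bsub>S\<^esub> X \<otimes>\<^bsub>S\<^esub> q"
  have r: "r \<in> carrier S" "\<And>k. k > m \<Longrightarrow> r k = \<zero>"
    using step q by (auto simp: r_def horner_coeff split: nat.split)
  have r_pi: "\<pi> (const \<alpha> \<oplus>\<^bsub>S\<^esub> X \<otimes>\<^bsub>S\<^esub> t) = \<pi> r"
    using step q by (simp add: r_def pi_add pi_mult)
  define q' where "q' = r \<oplus>\<^bsub>S\<^esub> f \<otimes>\<^bsub>S\<^esub> const (\<ominus> r m)"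
  have "q' k = \<zero>" if "k \<ge> m" for k
    using that r f_monic
    by (cases "k = m") (auto simp: q'_def S_add mult_const skew_monic_def r_neg)
  moreover have "\<pi> r = \<pi> q'"
    using r by (simp add: q'_def pi_add pi_mult pi_f)
  moreover have "q' \<in> carrier S" using r by (simp add: q'_def)
  ultimately show ?case using r_pi by auto
qed

lemma pi_X_pow: "\<pi> (X [^]\<^bsub>S\<^esub> (n::nat)) = x [^]\<^bsub>A\<^esub> n"
  by (induction n) (simp_all add: pi_one pi_mult quot_x_eq)

lemma lincomb_eq:
  assumes "c \<in> {..<n} \<rightarrow> carrier B"
  shows "quot_lincomb B \<rho> f n c = \<pi> (truncate n c)"
  using assms
proof (induction n)
  case 0
  have "truncate 0 c = \<zero>\<^bsub>S\<^esub>" by (simp add: truncate_def S_zero)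
  then show ?case by (simp add: quot_lincomb_def pi_zero)
next
  case (Suc n)
  have c: "\<And>k. k \<le> n \<Longrightarrow> c k \<in> carrier B" using Suc.prems by auto
  have "quot_lincomb B \<rho> f (Suc n) c = (x [^]\<^bsub>A\<^esub> n) \<otimes>\<^bsub>A\<^esub> \<pi> (const (c n)) \<oplus>\<^bsub>A\<^esub> quot_lincomb B \<rho> f n c"
    using c unfolding quot_lincomb_def lessThan_Suc quot_const_eq
    by (subst A.finsum_insert) (auto simp: quot_x_eq)
  also have "quot_lincomb B \<rho> f n c = \<pi> (truncate n c)" using Suc.IH c by auto
  also have "(x [^]\<^bsub>A\<^esub> n) \<otimes>\<^bsub>A\<^esub> \<pi> (const (c n)) \<oplus>\<^bsub>A\<^esub> \<pi> (truncate n c) = \<pi> (truncate (Suc n) c)"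
    using c by (subst truncate_Suc)
      (auto simp: pi_add pi_mult truncate_closed pi_X_pow quot_x_eq intro!: A.a_comm)
  finally show ?case .
qed

text \<open>The coefficientwise action of \<open>\<rho>\<close> is multiplicative and fixes \<open>f\<close>, so it maps \<open>f S\<close> into itself.
  This is what makes the description of \<open>\<rho>A\<close> by coefficients independent of their choice.\<close>

lemma pi_S_rho_cong:
  assumes "\<pi> p = \<pi> q" "p \<in> carrier S" "q \<in> carrier S"
  shows "\<pi> (S_rho p) = \<pi> (S_rho q)"
proof -
  obtain s where "s \<in> carrier S" "p = q \<oplus>\<^bsub>S\<^esub> f \<otimes>\<^bsub>S\<^esub> s" using assms by (rule pi_eqE)
  then show ?thesis
    using assms by (simp add: S_rho_add S_rho_mult S_rho_f pi_add pi_mult pi_f)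
qed

lemma quot_rho_pi:
  assumes p: "p \<in> carrier S"
  shows "\<rho>A (\<pi> p) = \<pi> (S_rho p)"
  unfolding quot_rho_def
proof (rule the_equality)
  have rho: "quot_lincomb B \<rho> f m (\<lambda>j. \<rho> (c j)) = \<pi> (S_rho (truncate m c))"
    if "c \<in> {..<m} \<rightarrow> carrier B" for c
  proof -
    have "truncate m (\<lambda>j. \<rho> (c j)) = S_rho (truncate m c)"
      by (auto simp: truncate_def S_rho_def)
    then show ?thesis using that by (subst lincomb_eq) (auto intro!: rho_closed)
  qed
  obtain q where q: "q \<in> carrier S" "\<forall>k\<ge>m. q k = \<zero>" "\<pi> p = \<pi> q"
    using division[OF p] by auto
  have "truncate m q = q" using q(2) by (auto simp: truncate_def)
  moreover have "q \<in> {..<m} \<rightarrow> carrier B" using q(1) by simp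
  ultimately have "\<pi> p = quot_lincomb B \<rho> f m q"
    and "\<pi> (S_rho p) = quot_lincomb B \<rho> f m (\<lambda>j. \<rho> (q j))"
    using lincomb_eq[of q m] rho[of q] pi_S_rho_cong[OF q(3) p q(1)] q(3) by simp_all
  then show "\<exists>c\<in>{..<m} \<rightarrow> carrier B. \<pi> p = quot_lincomb B \<rho> f m c \<and>
      \<pi> (S_rho p) = quot_lincomb B \<rho> f m (\<lambda>j. \<rho> (c j))"
    using \<open>q \<in> {..<m} \<rightarrow> carrier B\<close> by blast
  show "y = \<pi> (S_rho p)" if ex: "\<exists>c\<in>{..<m} \<rightarrow> carrier B. \<pi> p = quot_lincomb B \<rho> f m c \<and>
      y = quot_lincomb B \<rho> f m (\<lambda>j. \<rho> (c j))" for y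
  proof -
    obtain c where c: "c \<in> {..<m} \<rightarrow> carrier B" "\<pi> p = quot_lincomb B \<rho> f m c"
      and y: "y = quot_lincomb B \<rho> f m (\<lambda>j. \<rho> (c j))" using ex by blast
    have eq: "\<pi> p = \<pi> (truncate m c)" using c(2) lincomb_eq[OF c(1)] by (rule trans)
    then show ?thesis
      using y rho[OF c(1)] pi_S_rho_cong[OF eq p truncate_closed[OF c(1)]] by simp
  qed
qed

lemma x_closed [simp]: "x \<in> carrier A"
  by (simp add: quot_x_eq)

lemma quot_rho_closed [simp]: "y \<in> carrier A \<Longrightarrow> \<rho>A y \<in> carrier A"
  by (auto elim!: A_carrierE simp: quot_rho_pi)

lemma quot_rho_funpow_closed [simp]: "y \<in> carrier A \<Longrightarrow> (\<rho>A ^^ k) y \<in> carrier A"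
  by (induction k) auto

lemma mult_x: "y \<in> carrier A \<Longrightarrow> y \<otimes>\<^bsub>A\<^esub> x = x \<otimes>\<^bsub>A\<^esub> \<rho>A y"
  by (erule A_carrierE) (simp add: quot_rho_pi quot_x_eq mult_X flip: pi_mult)

lemma mult_x_pow: "y \<in> carrier A \<Longrightarrow> y \<otimes>\<^bsub>A\<^esub> (x [^]\<^bsub>A\<^esub> k) = (x [^]\<^bsub>A\<^esub> k) \<otimes>\<^bsub>A\<^esub> (\<rho>A ^^ k) y"
proof (induction k)
  case (Suc k)
  have "y \<otimes>\<^bsub>A\<^esub> (x [^]\<^bsub>A\<^esub> Suc k) = (y \<otimes>\<^bsub>A\<^esub> (x [^]\<^bsub>A\<^esub> k)) \<otimes>\<^bsub>A\<^esub> x"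
    using Suc.prems by (simp add: A.m_assoc)
  also have "\<dots> = (x [^]\<^bsub>A\<^esub> k) \<otimes>\<^bsub>A\<^esub> ((\<rho>A ^^ k) y \<otimes>\<^bsub>A\<^esub> x)"
    using Suc by (simp add: A.m_assoc)
  also have "\<dots> = (x [^]\<^bsub>A\<^esub> Suc k) \<otimes>\<^bsub>A\<^esub> (\<rho>A ^^ Suc k) y"
    using Suc.prems by (simp only: mult_x[OF quot_rho_funpow_closed]) (simp add: A.m_assoc)
  finally show ?case .
qed simp

abbreviation BA :: "(nat \<Rightarrow> 'a) set set" where "BA \<equiv> quot_const B \<rho> f ` carrier B"
abbreviation J :: "(nat \<Rightarrow> 'a) set set" where "J \<equiv> quot_J B \<rho> f 1"

lemma J_iff: "g \<in> J \<longleftrightarrow> skew_derivation B \<rho> A \<pi> g"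
  by (auto simp: quot_J_def quot_const_eq pi_hom
      skew_derivation_def skew_derivation_axioms_def skew_poly_axioms A.ring_axioms)

text \<open>The formula for \<open>\<tau>\<close> is a derivative of \<open>f\<close> with every \<open>x\<close> moved to the left: the derivation with
  \<open>D X = g\<close> sends \<open>X^(k + 1)\<close> to \<open>\<Sum>j\<le>k. x^(k - j) g x^j = x^k (\<Sum>j\<le>k. \<rho>A^j g)\<close>.\<close>

lemma tau_eq_D_f:
  assumes "g \<in> J"
  shows "\<tau> g = skew_derivation.D B A \<pi> g f"
proof -
  interpret skew_derivation B \<rho> A \<pi> g using assms by (rule J_iff[THEN iffD1])
  have f: "truncate (Suc m) f = f"
    using f_monic by (auto simp: truncate_def skew_monic_def)
  have "D f = (\<Oplus>\<^bsub>A\<^esub>k\<in>{..<m}. D (X [^]\<^bsub>S\<^esub> Suc k) \<otimes>\<^bsub>A\<^esub> \<pi> (const (f (Suc k))))"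
    using D_truncate[of f m] f by auto
  also have "\<dots> = \<tau> g"
    unfolding quot_tau_def
  proof (rule A.finsum_cong')
    fix k
    have "D (X [^]\<^bsub>S\<^esub> Suc k) = (x [^]\<^bsub>A\<^esub> k) \<otimes>\<^bsub>A\<^esub> (\<Oplus>\<^bsub>A\<^esub>j\<in>{..k}. (\<rho>A ^^ j) g)"
      unfolding quot_x_eq by (rule D_X_pow) (simp_all add: mult_x_pow flip: quot_x_eq)
    then show "D (X [^]\<^bsub>S\<^esub> Suc k) \<otimes>\<^bsub>A\<^esub> \<pi> (const (f (Suc k)))
        = (x [^]\<^bsub>A\<^esub> k) \<otimes>\<^bsub>A\<^esub> (\<Oplus>\<^bsub>A\<^esub>j\<in>{..k}. (\<rho>A ^^ j) g \<otimes>\<^bsub>A\<^esub> quot_const B \<rho> f (f (k + 1)))"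
      by (simp add: quot_const_eq A.m_assoc A.finsum_ldistr del: Group.nat_pow_Suc S.nat_pow_Suc)
  qed (simp_all add: quot_const_eq)
  finally show ?thesis ..
qed

text \<open>That \<open>\<delta> x\<close> lies in \<open>J\<close> is the relation \<open>\<alpha> x = x \<rho>(\<alpha>)\<close> differentiated.\<close>

lemma derivation_factors:
  assumes \<delta>: "is_derivation A BA \<delta>"
  shows "\<delta> x \<in> J" and "p \<in> carrier S \<Longrightarrow> \<delta> (\<pi> p) = skew_derivation.D B A \<pi> (\<delta> x) p"
proof -
  have closed: "\<And>y. y \<in> carrier A \<Longrightarrow> \<delta> y \<in> carrier A"
    and add: "\<And>y z. y \<in> carrier A \<Longrightarrow> z \<in> carrier A \<Longrightarrow> \<delta> (y \<oplus>\<^bsub>A\<^esub> z) = \<delta> y \<oplus>\<^bsub>A\<^esub> \<delta> z"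
    and mult: "\<And>y z. y \<in> carrier A \<Longrightarrow> z \<in> carrier A \<Longrightarrow>
      \<delta> (y \<otimes>\<^bsub>A\<^esub> z) = \<delta> y \<otimes>\<^bsub>A\<^esub> z \<oplus>\<^bsub>A\<^esub> y \<otimes>\<^bsub>A\<^esub> \<delta> z"
    and const: "\<And>\<alpha>. \<alpha> \<in> carrier B \<Longrightarrow> \<delta> (\<pi> (const \<alpha>)) = \<zero>\<^bsub>A\<^esub>"
    using \<delta> by (auto simp: is_derivation_def quot_const_eq)
  have "\<pi> (const \<alpha>) \<otimes>\<^bsub>A\<^esub> \<delta> x = \<delta> x \<otimes>\<^bsub>A\<^esub> \<pi> (const (\<rho> \<alpha>))" if "\<alpha> \<in> carrier B" for \<alpha>
  proof -
    have "\<pi> (const \<alpha>) \<otimes>\<^bsub>A\<^esub> x = x \<otimes>\<^bsub>A\<^esub> \<pi> (const (\<rho> \<alpha>))"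
      using that by (simp add: quot_x_eq const_mult_X flip: pi_mult)
    then have "\<delta> (\<pi> (const \<alpha>) \<otimes>\<^bsub>A\<^esub> x) = \<delta> (x \<otimes>\<^bsub>A\<^esub> \<pi> (const (\<rho> \<alpha>)))" by simp
    then show ?thesis using that by (simp add: mult const closed)
  qed
  then show J: "\<delta> x \<in> J" by (simp add: quot_J_def quot_const_eq closed)
  interpret skew_derivation B \<rho> A \<pi> "\<delta> x" using J by (rule J_iff[THEN iffD1])
  show "\<delta> (\<pi> p) = D p" if "p \<in> carrier S"
    using that by (intro derivation_eq_D add mult const) (simp_all add: quot_x_eq)
qed

text \<open>Here \<open>f\<close> maps to \<open>0\<close> in \<open>A\<close>, so its derivative must vanish.\<close>

lemma derivation_tau:
  assumes "is_derivation A BA \<delta>"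
  shows "\<tau> (\<delta> x) = \<zero>\<^bsub>A\<^esub>"
proof -
  note d = derivation_factors[OF assms]
  interpret skew_derivation B \<rho> A \<pi> "\<delta> x" using d(1) by (rule J_iff[THEN iffD1])
  have "\<tau> (\<delta> x) = D f" by (rule tau_eq_D_f[OF d(1)])
  also have "\<dots> = \<delta> (\<pi> \<zero>\<^bsub>S\<^esub>)" using d(2)[OF f_closed] by (simp add: pi_f pi_zero)
  also have "\<dots> = \<zero>\<^bsub>A\<^esub>" using d(2)[of "\<zero>\<^bsub>S\<^esub>"] by simp
  finally show ?thesis .
qed

text \<open>Conversely \<open>D\<close> descends to \<open>A\<close>: once \<open>D f = 0\<close>, the Leibniz rule makes \<open>D\<close> vanish on
  all of \<open>f S\<close>.\<close>

lemma derivation_exists: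
  assumes J: "g \<in> J" and \<tau>: "\<tau> g = \<zero>\<^bsub>A\<^esub>"
  obtains \<delta> where "is_derivation A BA \<delta>" "\<delta> x = g"
proof -
  interpret skew_derivation B \<rho> A \<pi> g using J by (rule J_iff[THEN iffD1])
  have Df: "D f = \<zero>\<^bsub>A\<^esub>" using tau_eq_D_f[OF J] \<tau> by simp
  have cong: "D p = D q" if pq: "\<pi> p = \<pi> q" "p \<in> carrier S" "q \<in> carrier S" for p q
  proof -
    obtain s where "s \<in> carrier S" "p = q \<oplus>\<^bsub>S\<^esub> f \<otimes>\<^bsub>S\<^esub> s" using pq by (rule pi_eqE)
    then show ?thesis using pq by (simp add: D_add D_mult Df pi_f)
  qed
  define \<delta> where "\<delta> y = D (SOME p. p \<in> carrier S \<and> \<pi> p = y)" for y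
  have \<delta>: "\<delta> (\<pi> p) = D p" if "p \<in> carrier S" for p
    unfolding \<delta>_def using that by (intro cong; metis (mono_tags, lifting) someI_ex)
  have "is_derivation A BA \<delta>"
    unfolding is_derivation_def
  proof (intro conjI ballI)
    show "\<delta> \<in> carrier A \<rightarrow> carrier A" by (auto elim!: A_carrierE simp: \<delta>)
    show "\<delta> \<beta> = \<zero>\<^bsub>A\<^esub>" if "\<beta> \<in> BA" for \<beta> using that by (auto simp: quot_const_eq \<delta>)
    fix y z assume "y \<in> carrier A" "z \<in> carrier A"
    then obtain p q where p: "p \<in> carrier S" "y = \<pi> p" and q: "q \<in> carrier S" "z = \<pi> q"
      by (meson A_carrierE)
    show "\<delta> (y \<oplus>\<^bsub>A\<^esub> z) = \<delta> y \<oplus>\<^bsub>A\<^esub> \<delta> z"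
      using p q by (simp add: \<delta> D_add flip: pi_add)
    have "\<delta> (y \<otimes>\<^bsub>A\<^esub> z) = D (p \<otimes>\<^bsub>S\<^esub> q)" using p q \<delta>[of "p \<otimes>\<^bsub>S\<^esub> q"] by simp
    then show "\<delta> (y \<otimes>\<^bsub>A\<^esub> z) = \<delta> y \<otimes>\<^bsub>A\<^esub> z \<oplus>\<^bsub>A\<^esub> y \<otimes>\<^bsub>A\<^esub> \<delta> z"
      using p q by (simp add: \<delta> D_mult)
  qed
  moreover have "\<delta> x = g" by (simp add: \<delta> quot_x_eq)
  ultimately show thesis by (rule that)
qed

lemma derivations_eq_if_eq_at_x:
  assumes "is_derivation A BA \<delta>" "is_derivation A BA \<epsilon>" "\<delta> x = \<epsilon> x" "y \<in> carrier A"
  shows "\<delta> y = \<epsilon> y"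
  using assms by (metis A_carrierE derivation_factors(2))

definition ad :: "(nat \<Rightarrow> 'a) set \<Rightarrow> (nat \<Rightarrow> 'a) set \<Rightarrow> (nat \<Rightarrow> 'a) set" where
  "ad u y = u \<otimes>\<^bsub>A\<^esub> y \<ominus>\<^bsub>A\<^esub> y \<otimes>\<^bsub>A\<^esub> u"

text \<open>The bridge to the right-hand side of the theorem: \<open>u x = x (\<rho>A u)\<close>.\<close>

lemma ad_x:
  assumes "u \<in> carrier A"
  shows "ad u x = x \<otimes>\<^bsub>A\<^esub> (\<rho>A u \<ominus>\<^bsub>A\<^esub> u)"
  using assms by (simp add: ad_def mult_x A.minus_eq A.r_distr A.r_minus)

lemma ad_derivation:
  assumes "u \<in> quot_V B \<rho> f"
  shows "is_derivation A BA (ad u)"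
proof -
  have u: "u \<in> carrier A" "\<And>\<beta>. \<beta> \<in> BA \<Longrightarrow> \<beta> \<otimes>\<^bsub>A\<^esub> u = u \<otimes>\<^bsub>A\<^esub> \<beta>"
    using assms by (auto simp: quot_V_def centralizer_in_def)
  have BA: "\<And>\<beta>. \<beta> \<in> BA \<Longrightarrow> \<beta> \<in> carrier A" by (auto simp: quot_const_eq)
  have "ad u (y \<otimes>\<^bsub>A\<^esub> z) = ad u y \<otimes>\<^bsub>A\<^esub> z \<oplus>\<^bsub>A\<^esub> y \<otimes>\<^bsub>A\<^esub> ad u z"
    if "y \<in> carrier A" "z \<in> carrier A" for y z
  proof -
    have "ad u y \<otimes>\<^bsub>A\<^esub> z \<oplus>\<^bsub>A\<^esub> y \<otimes>\<^bsub>A\<^esub> ad u z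
      = u \<otimes>\<^bsub>A\<^esub> y \<otimes>\<^bsub>A\<^esub> z \<oplus>\<^bsub>A\<^esub> (\<ominus>\<^bsub>A\<^esub> (y \<otimes>\<^bsub>A\<^esub> u \<otimes>\<^bsub>A\<^esub> z) \<oplus>\<^bsub>A\<^esub> y \<otimes>\<^bsub>A\<^esub> u \<otimes>\<^bsub>A\<^esub> z) \<oplus>\<^bsub>A\<^esub> \<ominus>\<^bsub>A\<^esub> (y \<otimes>\<^bsub>A\<^esub> z \<otimes>\<^bsub>A\<^esub> u)"
      using that u(1)
      by (simp add: ad_def A.minus_eq A.l_distr A.r_distr A.l_minus A.r_minus A.m_assoc A.a_assoc)
    also have "\<dots> = ad u (y \<otimes>\<^bsub>A\<^esub> z)"
      using that u(1) by (simp add: ad_def A.minus_eq A.l_neg A.m_assoc)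
    finally show ?thesis ..
  qed
  moreover have "ad u (y \<oplus>\<^bsub>A\<^esub> z) = ad u y \<oplus>\<^bsub>A\<^esub> ad u z" if "y \<in> carrier A" "z \<in> carrier A" for y z
    using that u(1) by (simp add: ad_def A.minus_eq A.l_distr A.r_distr A.minus_add A.a_ac)
  moreover have "ad u \<beta> = \<zero>\<^bsub>A\<^esub>" if "\<beta> \<in> BA" for \<beta>
    using that u BA by (simp add: ad_def A.minus_eq A.r_neg)
  ultimately show ?thesis
    using u(1) by (auto simp: is_derivation_def ad_def)
qed

lemma inner_derivation_from_V:
  assumes \<delta>: "is_derivation A BA \<delta>" and u: "u \<in> carrier A"
    and eq: "\<And>y. y \<in> carrier A \<Longrightarrow> \<delta> y = ad u y"
  shows "u \<in> quot_V B \<rho> f"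
proof -
  have "\<beta> \<otimes>\<^bsub>A\<^esub> u = u \<otimes>\<^bsub>A\<^esub> \<beta>" if "\<beta> \<in> BA" for \<beta>
  proof -
    have \<beta>: "\<beta> \<in> carrier A" using that by (auto simp: quot_const_eq)
    then have "u \<otimes>\<^bsub>A\<^esub> \<beta> \<ominus>\<^bsub>A\<^esub> \<beta> \<otimes>\<^bsub>A\<^esub> u = \<zero>\<^bsub>A\<^esub>"
      using \<delta> that eq by (auto simp: is_derivation_def ad_def)
    moreover have "u \<otimes>\<^bsub>A\<^esub> \<beta> = (u \<otimes>\<^bsub>A\<^esub> \<beta> \<ominus>\<^bsub>A\<^esub> \<beta> \<otimes>\<^bsub>A\<^esub> u) \<oplus>\<^bsub>A\<^esub> \<beta> \<otimes>\<^bsub>A\<^esub> u"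
      using u \<beta> by (simp add: A.minus_eq A.a_assoc A.l_neg)
    ultimately show ?thesis using u \<beta> by simp
  qed
  then show ?thesis using u by (auto simp: quot_V_def centralizer_in_def)
qed

text \<open>Under \<open>\<delta> \<mapsto> \<delta> x\<close> the derivations correspond to the kernel of \<open>\<tau>\<close> on \<open>J\<close>, and the inner
  ones to the elements \<open>x (\<rho>A h - h)\<close> with \<open>h\<close> in the centralizer.\<close>

lemma weakly_separable_iff:
  "weakly_separable_poly B \<rho> f \<longleftrightarrow>
    {g \<in> J. \<tau> g = \<zero>\<^bsub>A\<^esub>} = {x \<otimes>\<^bsub>A\<^esub> (\<rho>A h \<ominus>\<^bsub>A\<^esub> h) | h. h \<in> quot_V B \<rho> f}"
  (is "?ws \<longleftrightarrow> ?K = ?L")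
proof -
  have V: "\<And>h. h \<in> quot_V B \<rho> f \<Longrightarrow> h \<in> carrier A"
    by (simp add: quot_V_def centralizer_in_def)
  have LK: "?L \<subseteq> ?K"
  proof
    fix g assume "g \<in> ?L"
    then obtain h where h: "h \<in> quot_V B \<rho> f" and g: "g = ad h x" using V ad_x by auto
    show "g \<in> ?K"
      unfolding g using ad_derivation[OF h] derivation_factors(1) derivation_tau by blast
  qed
  show ?thesis
  proof
    assume ws: ?ws
    have "?K \<subseteq> ?L"
    proof
      fix g assume "g \<in> ?K"
      then obtain \<delta> where \<delta>: "is_derivation A BA \<delta>" and g: "\<delta> x = g"
        using derivation_exists by blast
      have "is_inner A \<delta>"
        using ws \<delta> by (simp add: weakly_separable_poly_def weakly_separable_ext_def)
      then obtain u where u: "u \<in> carrier A" and eq: "\<And>y. y \<in> carrier A \<Longrightarrow> \<delta> y = ad u y"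
        by (auto simp: is_inner_def ad_def)
      have "u \<in> quot_V B \<rho> f" using \<delta> u eq by (rule inner_derivation_from_V)
      moreover have "g = x \<otimes>\<^bsub>A\<^esub> (\<rho>A u \<ominus>\<^bsub>A\<^esub> u)" using g eq[OF x_closed] ad_x[OF u] by simp
      ultimately show "g \<in> ?L" by blast
    qed
    with LK show "?K = ?L" by blast
  next
    assume KL: "?K = ?L"
    have "is_inner A \<delta>" if \<delta>: "is_derivation A BA \<delta>" for \<delta>
    proof -
      have "\<delta> x \<in> ?K" using derivation_factors(1)[OF \<delta>] derivation_tau[OF \<delta>] by blast
      then have "\<delta> x \<in> ?L" unfolding KL .
      then obtain h where h: "h \<in> quot_V B \<rho> f" and "\<delta> x = x \<otimes>\<^bsub>A\<^esub> (\<rho>A h \<ominus>\<^bsub>A\<^esub> h)"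
        by blast
      then have "\<delta> x = ad h x" using V ad_x by simp
      then have "\<forall>y\<in>carrier A. \<delta> y = ad h y"
        using derivations_eq_if_eq_at_x[OF \<delta> ad_derivation[OF h]] by blast
      then show ?thesis unfolding is_inner_def using V[OF h] by (auto simp: ad_def)
    qed
    then show ?ws by (simp add: weakly_separable_poly_def weakly_separable_ext_def)
  qed
qed

end

theorem theorem3p2:
  fixes B :: "('a, 'm) ring_scheme" and \<rho> :: "'a \<Rightarrow> 'a"
    and f :: "nat \<Rightarrow> 'a" and m :: nat
  assumes "ring B"
    and "\<rho> \<in> ring_iso B B"
    and "m \<ge> 2"
    and "skew_monic B m f"
    and "f \<in> skew_poly_0 B \<rho> \<inter> fixed_polys B \<rho>"
  shows "weakly_separable_poly B \<rho> f \<longleftrightarrow>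
    {g \<in> quot_J B \<rho> f 1. quot_tau B \<rho> f m g = \<zero>\<^bsub>skew_quot B \<rho> f\<^esub>} =
    {quot_x B \<rho> f \<otimes>\<^bsub>skew_quot B \<rho> f\<^esub> (quot_rho B \<rho> f m h \<ominus>\<^bsub>skew_quot B \<rho> f\<^esub> h) | h.
       h \<in> quot_V B \<rho> f}"
proof -
  interpret skew_quotient B \<rho> f m
    using assms by (simp add: skew_quotient_def skew_quotient_axioms_def
        skew_poly_def skew_poly_axioms_def)
  show ?thesis by (rule weakly_separable_iff)
qed

end
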